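(* Let $\mathcal{A},\mathcal{B}$ be $C^*$-algebras, let $\Phi:\mathcal{A}\to\mathcal{B}$ be a tracial $2$-positive linear map, let $\rho\in\mathcal{A}$ be a $\Phi$-density operator and let $\alpha\in[0,1]$. Then for every self-adjoint $A\in\mathcal{A}$, $$0\;\leq\; I^{\alpha}_{\rho,\Phi}(A)\;\leq\; I_{\rho,\Phi}(A)\;\leq\; V_{\rho,\Phi}(A).$$
   Context: A linear map $\Phi$ between $C^*$-algebras is tracial if $\Phi(XY)=\Phi(YX)$ for all $X,Y$; it is $2$-positive if the map $[a_{ij}]\mapsto[\Phi(a_{ij})]$ from $M_2(\mathcal{A})$ to $M_2(\mathcal{B})$ is positive (maps positive elements to positive elements). A $\Phi$-density operator is a positive $\rho\in\mathcal{A}$ with $\Phi(\rho)=I$, the unit of $\mathcal{B}$. The generalized variance is $V_{\rho,\Phi}(A)=\Phi(\rho A^*A)-\Phi(\rho A^* )\Phi(\rho A)$. The generalized Wigner--Yanase--Dyson skew information is $$I^{\alpha}_{\rho,\Phi}(A)=\Phi(\rho A^*A)-\Phi(\rho^{1-\alpha}A^*\rho^{\alpha}A)\qquad(\alpha\in[0,1]),$$ with $\rho^0=I$, and $I_{\rho,\Phi}(A):=I^{1/2}_{\rho,\Phi}(A)$. *)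

theory Defs
  imports "HOL-Analysis.Analysis" "HOL-Computational_Algebra.Polynomial"
begin

text \<open>
  Unital complex \<open>C\<^sup>*\<close>-algebras as a type class. The superclasses supply the real Banach algebra
  structure and the unit; \<open>norm_scaleC\<close> makes the norm complex homogeneous. The algebra is nonzero
  because \<open>0 \<noteq> 1\<close> in \<open>real_normed_algebra_1\<close>, and then the axiom \<open>norm 1 = 1\<close> of that class
  already follows from \<open>cstar_identity\<close>.
\<close>

class cstar_algebra = real_normed_algebra_1 + banach +
  fixes scaleC :: "complex \<Rightarrow> 'a \<Rightarrow> 'a" (infixr "*\<^sub>C" 75)
    and star :: "'a \<Rightarrow> 'a" ("_\<^sup>\<star>" [1000] 999)
  assumes scaleR_scaleC: "r *\<^sub>R x = complex_of_real r *\<^sub>C x"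
    and scaleC_add_right: "c *\<^sub>C (x + y) = c *\<^sub>C x + c *\<^sub>C y"
    and scaleC_add_left: "(c + d) *\<^sub>C x = c *\<^sub>C x + d *\<^sub>C x"
    and scaleC_scaleC: "c *\<^sub>C (d *\<^sub>C x) = (c * d) *\<^sub>C x"
    and mult_scaleC_left: "(c *\<^sub>C x) * y = c *\<^sub>C (x * y)"
    and mult_scaleC_right: "x * (c *\<^sub>C y) = c *\<^sub>C (x * y)"
    and norm_scaleC: "norm (c *\<^sub>C x) = cmod c * norm x"
    and star_star: "(x\<^sup>\<star>)\<^sup>\<star> = x"
    and star_add: "(x + y)\<^sup>\<star> = x\<^sup>\<star> + y\<^sup>\<star>"
    and star_scaleC: "(c *\<^sub>C x)\<^sup>\<star> = cnj c *\<^sub>C x\<^sup>\<star>"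
    and star_mult: "(x * y)\<^sup>\<star> = y\<^sup>\<star> * x\<^sup>\<star>"
    and cstar_identity: "norm (x\<^sup>\<star> * x) = (norm x)\<^sup>2"

definition self_adjoint :: "'a::cstar_algebra \<Rightarrow> bool" where
  "self_adjoint a \<longleftrightarrow> a\<^sup>\<star> = a"

definition positive_element :: "'a::cstar_algebra \<Rightarrow> bool" where
  "positive_element a \<longleftrightarrow> (\<exists>b. a = b\<^sup>\<star> * b)"

definition cstar_le :: "'a::cstar_algebra \<Rightarrow> 'a \<Rightarrow> bool" (infix "\<preceq>" 50) where
  "a \<preceq> b \<longleftrightarrow> positive_element (b - a)"

text \<open>
  \<open>M\<^sub>2(A)\<close> is the type \<open>'a^2^2\<close> with the library product \<open>**\<close> and the involution below. Positivity in
  a \<open>C\<^sup>*\<close>-algebra depends only on its \<open>*\<close>-algebra structure, so no norm on \<open>M\<^sub>2(A)\<close> is introduced.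
\<close>

definition mat_star :: "'a::cstar_algebra^2^2 \<Rightarrow> 'a^2^2" where
  "mat_star M = (\<chi> i j. (M $ j $ i)\<^sup>\<star>)"

definition positive_matrix :: "'a::cstar_algebra^2^2 \<Rightarrow> bool" where
  "positive_matrix M \<longleftrightarrow> (\<exists>N. M = mat_star N ** N)"

definition complex_linear :: "('a::cstar_algebra \<Rightarrow> 'b::cstar_algebra) \<Rightarrow> bool" where
  "complex_linear \<Phi> \<longleftrightarrow>
     (\<forall>X Y. \<Phi> (X + Y) = \<Phi> X + \<Phi> Y) \<and> (\<forall>c X. \<Phi> (c *\<^sub>C X) = c *\<^sub>C \<Phi> X)"

definition tracial :: "('a::cstar_algebra \<Rightarrow> 'b::cstar_algebra) \<Rightarrow> bool" where
  "tracial \<Phi> \<longleftrightarrow> (\<forall>X Y. \<Phi> (X * Y) = \<Phi> (Y * X))"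

definition two_positive :: "('a::cstar_algebra \<Rightarrow> 'b::cstar_algebra) \<Rightarrow> bool" where
  "two_positive \<Phi> \<longleftrightarrow>
     (\<forall>M :: 'a^2^2. positive_matrix M \<longrightarrow> positive_matrix (\<chi> i j. \<Phi> (M $ i $ j)))"

definition density_operator :: "('a::cstar_algebra \<Rightarrow> 'b::cstar_algebra) \<Rightarrow> 'a \<Rightarrow> bool" where
  "density_operator \<Phi> \<rho> \<longleftrightarrow> positive_element \<rho> \<and> \<Phi> \<rho> = 1"

definition spectrum :: "'a::cstar_algebra \<Rightarrow> complex set" where
  "spectrum a = {z. \<not> (\<exists>b. (a - z *\<^sub>C 1) * b = 1 \<and> b * (a - z *\<^sub>C 1) = 1)}"

definition poly_at :: "complex poly \<Rightarrow> 'a::cstar_algebra \<Rightarrow> 'a" where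
  "poly_at p a = (\<Sum>i\<le>degree p. coeff p i *\<^sub>C a ^ i)"

text \<open>
  Continuous functional calculus, for self-adjoint \<open>a\<close> and \<open>f\<close> continuous on \<open>spectrum a\<close>: since
  \<open>spectrum a\<close> is a compact set of reals, \<open>f\<close> is a uniform limit of polynomials on it, and \<open>f(a)\<close>
  is the common norm limit of \<open>p n (a)\<close> over all such sequences \<open>p\<close>.
\<close>

definition cfc :: "(complex \<Rightarrow> complex) \<Rightarrow> 'a::cstar_algebra \<Rightarrow> 'a" where
  "cfc f a = (THE b. \<forall>p :: nat \<Rightarrow> complex poly.
     uniform_limit (spectrum a) (\<lambda>n. poly (p n)) f sequentially \<longrightarrow>
     (\<lambda>n. poly_at (p n) a) \<longlonglongrightarrow> b)"

text \<open>
  Powers \<open>a\<^sup>t\<close> with \<open>t \<ge> 0\<close> of a positive \<open>a\<close>. The case \<open>t = 0\<close> is separate because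
  \<open>0 powr 0 = 0\<close>.
\<close>

definition cstar_power :: "'a::cstar_algebra \<Rightarrow> real \<Rightarrow> 'a" where
  "cstar_power a t =
     (if t = 0 then 1 else cfc (\<lambda>z. complex_of_real (Re z powr t)) a)"

definition gen_variance :: "('a::cstar_algebra \<Rightarrow> 'b::cstar_algebra) \<Rightarrow> 'a \<Rightarrow> 'a \<Rightarrow> 'b" where
  "gen_variance \<Phi> \<rho> A = \<Phi> (\<rho> * A\<^sup>\<star> * A) - \<Phi> (\<rho> * A\<^sup>\<star>) * \<Phi> (\<rho> * A)"

definition wyd_skew_info ::
    "real \<Rightarrow> ('a::cstar_algebra \<Rightarrow> 'b::cstar_algebra) \<Rightarrow> 'a \<Rightarrow> 'a \<Rightarrow> 'b" where
  "wyd_skew_info \<alpha> \<Phi> \<rho> A =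
     \<Phi> (\<rho> * A\<^sup>\<star> * A) - \<Phi> (cstar_power \<rho> (1 - \<alpha>) * A\<^sup>\<star> * cstar_power \<rho> \<alpha> * A)"

definition wy_skew_info ::
    "('a::cstar_algebra \<Rightarrow> 'b::cstar_algebra) \<Rightarrow> 'a \<Rightarrow> 'a \<Rightarrow> 'b" where
  "wy_skew_info = wyd_skew_info (1/2)"

end

theory Submission
  imports Defs "HOL-Computational_Algebra.Fundamental_Theorem_Algebra"
begin

text \<open>
  Everything is governed by the correlation \<open>g(t) = \<Phi>(\<rho>\<^bsup>1-t\<^esup> A \<rho>\<^bsup>t\<^esup> A)\<close> on \<open>[0,1]\<close>: the skew information
  is \<open>g(0) - g(\<alpha>)\<close>, and the variance is \<open>g(0) - \<Phi>(\<rho> A)\<^sup>2\<close>. So the claim is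
  \<open>\<Phi>(\<rho> A)\<^sup>2 \<le> g(1/2) \<le> g(\<alpha>) \<le> g(0)\<close>.

  The trace property makes \<open>g\<close> symmetric about \<open>1/2\<close> and its second differences of the form
  \<open>\<Phi>(X X\<^sup>\<star>)\<close>, hence positive (\<open>wyd_correlation_midpoint_convex\<close>). Convexity and symmetry give
  \<open>g(1/2) \<le> g(\<alpha>)\<close> at once. For \<open>g(\<alpha>) \<le> g(0)\<close> the usual passage from midpoint convexity to
  convexity by continuity is avoided: \<open>g(t) - g(0)\<close> has a bound \<open>c\<close> uniform in \<open>t\<close>, midpoint convexity
  improves \<open>c\<close> to \<open>c/2\<close>, and iterating leaves \<open>0\<close> (\<open>wyd_correlation_le_zero\<close>). The lower bound of
  \<open>g(1/2)\<close> is the Schwarz inequality for 2-positive maps, applied to \<open>\<rho>\<^bsup>1/4\<^esup> A \<rho>\<^bsup>1/4\<^esup>\<close> and \<open>\<rho>\<^bsup>1/2\<^esup>\<close>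
  (\<open>wyd_correlation_half_ge\<close>).

  The rest is the \<open>C\<^sup>*\<close>-algebra theory behind these steps. The norm of a self-adjoint element is
  attained on its spectrum, by Rickart's elementary argument with roots of unity
  (\<open>spectrum_attains_norm\<close>). With the spectral mapping theorem for polynomials this bounds
  \<open>\<parallel>p(a)\<parallel>\<close> by the supremum of \<open>\<bar>p\<bar>\<close> on the spectrum, so the functional calculus converges and the
  powers \<open>\<rho>\<^sup>t\<close> obey the exponent law. Finally the elements \<open>b\<^sup>\<star> b\<close> are exactly the self-adjoint
  elements with nonnegative spectrum, and these form a convex cone
  (\<open>positive_element_iff_nonneg_spectrum\<close>, \<open>nonneg_spectrum_add\<close>).
\<close>

section \<open>Scalars and the involution\<close>

lemma scaleC_zero_left [simp]: "0 *\<^sub>C (x::'a::cstar_algebra) = 0"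
  using scaleR_scaleC[of 0 x] by simp

lemma scaleC_one [simp]: "1 *\<^sub>C (x::'a::cstar_algebra) = x"
  using scaleR_scaleC[of 1 x] by simp

lemma scaleC_zero_right [simp]: "c *\<^sub>C (0::'a::cstar_algebra) = 0"
  using scaleC_add_right[of c 0 "0::'a"] by simp

lemma scaleC_minus_left [simp]: "(- c) *\<^sub>C (x::'a::cstar_algebra) = - (c *\<^sub>C x)"
  using scaleC_add_left[of c "- c" x] by (simp add: eq_neg_iff_add_eq_0 add.commute)

lemma scaleC_minus_right [simp]: "c *\<^sub>C (- (x::'a::cstar_algebra)) = - (c *\<^sub>C x)"
  using scaleC_add_right[of c x "- x"] by (simp add: eq_neg_iff_add_eq_0 add.commute)

lemma scaleC_diff_left: "(c - d) *\<^sub>C (x::'a::cstar_algebra) = c *\<^sub>C x - d *\<^sub>C x"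
  using scaleC_add_left[of c "- d" x] by simp

lemma scaleC_diff_right: "c *\<^sub>C (x - (y::'a::cstar_algebra)) = c *\<^sub>C x - c *\<^sub>C y"
  using scaleC_add_right[of c x "- y"] by simp

lemma scaleC_sum_right: "c *\<^sub>C sum f S = (\<Sum>i\<in>S. c *\<^sub>C (f i :: 'a::cstar_algebra))"
  by (induction S rule: infinite_finite_induct) (simp_all add: scaleC_add_right)

lemma scaleC_power: "(c *\<^sub>C (x::'a::cstar_algebra)) ^ n = c ^ n *\<^sub>C x ^ n"
  by (induction n)
    (simp_all add: mult_scaleC_left mult_scaleC_right scaleC_scaleC mult.commute)

lemma star_zero [simp]: "(0::'a::cstar_algebra)\<^sup>\<star> = 0"
  using star_add[of 0 "0::'a"] by simp

lemma star_one [simp]: "(1::'a::cstar_algebra)\<^sup>\<star> = 1"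
  by (metis mult.right_neutral star_mult star_star)

lemma star_minus [simp]: "(- (x::'a::cstar_algebra))\<^sup>\<star> = - x\<^sup>\<star>"
  using star_add[of x "- x"] by (simp add: eq_neg_iff_add_eq_0 add.commute)

lemma star_diff: "((x::'a::cstar_algebra) - y)\<^sup>\<star> = x\<^sup>\<star> - y\<^sup>\<star>"
  using star_add[of x "- y"] by simp

lemma star_scaleR: "(r *\<^sub>R (x::'a::cstar_algebra))\<^sup>\<star> = r *\<^sub>R x\<^sup>\<star>"
  by (simp add: scaleR_scaleC star_scaleC)

lemma star_sum: "(sum f S)\<^sup>\<star> = (\<Sum>i\<in>S. (f i :: 'a::cstar_algebra)\<^sup>\<star>)"
  by (induction S rule: infinite_finite_induct) (simp_all add: star_add)

lemma star_power: "((x::'a::cstar_algebra) ^ n)\<^sup>\<star> = (x\<^sup>\<star>) ^ n"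
  by (induction n) (simp_all add: star_mult power_commutes)

lemma norm_star [simp]: "norm ((x::'a::cstar_algebra)\<^sup>\<star>) = norm x"
proof -
  have le: "norm y \<le> norm (y\<^sup>\<star>)" for y :: 'a
  proof (cases "norm y = 0")
    case False
    have "norm y * norm y \<le> norm (y\<^sup>\<star>) * norm y"
      using norm_mult_ineq[of "y\<^sup>\<star>" y] by (simp add: cstar_identity power2_eq_square)
    then show ?thesis using False by (simp add: mult_le_cancel_right)
  qed simp
  show ?thesis using le[of x] le[of "x\<^sup>\<star>"] by (simp add: star_star)
qed

lemma tendsto_star:
  assumes "(f \<longlongrightarrow> (l::'a::cstar_algebra)) F"
  shows "((\<lambda>n. (f n)\<^sup>\<star>) \<longlongrightarrow> l\<^sup>\<star>) F"
proof -
  have "((\<lambda>n. norm (f n - l)) \<longlongrightarrow> 0) F"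
    by (intro tendsto_norm_zero LIM_zero assms)
  then have "((\<lambda>n. norm ((f n)\<^sup>\<star> - l\<^sup>\<star>)) \<longlongrightarrow> 0) F"
    by (simp add: star_diff[symmetric])
  then show ?thesis by (rule LIM_zero_cancel[OF tendsto_norm_zero_cancel])
qed

lemma self_adjoint_one [simp]: "self_adjoint 1"
  by (simp add: self_adjoint_def)

lemma self_adjoint_add: "self_adjoint a \<Longrightarrow> self_adjoint b \<Longrightarrow> self_adjoint (a + b)"
  and self_adjoint_diff: "self_adjoint a \<Longrightarrow> self_adjoint b \<Longrightarrow> self_adjoint (a - b)"
  and self_adjoint_scaleR: "self_adjoint a \<Longrightarrow> self_adjoint (r *\<^sub>R a)"
  by (simp_all add: self_adjoint_def star_add star_diff star_scaleR)

lemma self_adjoint_power: "self_adjoint a \<Longrightarrow> self_adjoint (a ^ n)"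
  by (simp add: self_adjoint_def star_power)

lemma self_adjoint_star_mult: "self_adjoint (b\<^sup>\<star> * b)"
  by (simp add: self_adjoint_def star_mult star_star)

section \<open>Invertible elements and the spectrum\<close>

definition inverse_of :: "'a::cstar_algebra \<Rightarrow> 'a \<Rightarrow> bool" where
  "inverse_of x y \<longleftrightarrow> x * y = 1 \<and> y * x = 1"

definition has_inverse :: "'a::cstar_algebra \<Rightarrow> bool" where
  "has_inverse x \<longleftrightarrow> (\<exists>y. inverse_of x y)"

lemma spectrum_iff: "z \<in> spectrum a \<longleftrightarrow> \<not> has_inverse (a - z *\<^sub>C 1)"
  by (simp add: spectrum_def has_inverse_def inverse_of_def)

lemma inverse_of_mult:
  "inverse_of x x' \<Longrightarrow> inverse_of y y' \<Longrightarrow> inverse_of (x * y) (y' * x')"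
  unfolding inverse_of_def by (metis mult.assoc mult.right_neutral)

lemma has_inverse_mult: "has_inverse x \<Longrightarrow> has_inverse y \<Longrightarrow> has_inverse (x * y)"
  unfolding has_inverse_def using inverse_of_mult by blast

lemma has_inverse_one: "has_inverse 1"
  unfolding has_inverse_def inverse_of_def by auto

lemma has_inverse_scaleC:
  assumes "c \<noteq> 0" shows "has_inverse (c *\<^sub>C x) \<longleftrightarrow> has_inverse x"
proof -
  have *: "has_inverse (d *\<^sub>C y)" if "has_inverse y" "d \<noteq> 0" for y :: 'a and d
  proof -
    obtain y' where "inverse_of y y'" using \<open>has_inverse y\<close> has_inverse_def by blast
    then have "inverse_of (d *\<^sub>C y) (inverse d *\<^sub>C y')"
      using \<open>d \<noteq> 0\<close>
      by (simp add: inverse_of_def mult_scaleC_left mult_scaleC_right scaleC_scaleC)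
    then show ?thesis using has_inverse_def by blast
  qed
  show ?thesis
    using *[of x c] *[of "c *\<^sub>C x" "inverse c"] assms by (auto simp: scaleC_scaleC)
qed

lemma has_inverse_minus: "has_inverse (- x) \<longleftrightarrow> has_inverse x"
  using has_inverse_scaleC[of "-1" x] by simp

text \<open>The Neumann series \<open>\<Sum>x\<^sup>n\<close> inverts \<open>1 - x\<close>.\<close>

lemma has_inverse_one_minus:
  assumes "norm (x::'a::cstar_algebra) < 1" shows "has_inverse (1 - x)"
proof -
  have s: "summable (\<lambda>n. x ^ n)" using assms by (rule complete_algebra_summable_geometric)
  let ?y = "\<Sum>n. x ^ n"
  have 1: "?y = 1 + (\<Sum>n. x ^ Suc n)"
    using suminf_split_head[OF s] by simp
  have "(\<Sum>n. x ^ Suc n) = x * ?y" "(\<Sum>n. x ^ Suc n) = ?y * x"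
    using suminf_mult[OF s, of x] suminf_mult2[OF s, of x] by (simp_all add: power_commutes)
  with 1 have "?y = 1 + x * ?y" "?y = 1 + ?y * x" by metis+
  then have "inverse_of (1 - x) ?y"
    by (simp add: inverse_of_def left_diff_distrib right_diff_distrib diff_eq_eq)
  then show ?thesis using has_inverse_def by blast
qed

lemma spectrum_le_norm:
  assumes "z \<in> spectrum a" shows "cmod z \<le> norm a"
proof (rule ccontr)
  assume "\<not> cmod z \<le> norm a"
  then have z: "norm a < cmod z" "z \<noteq> 0" by (auto simp: not_le)
  have "norm (inverse z *\<^sub>C a) < 1"
    using z by (simp add: norm_scaleC norm_inverse norm_divide divide_simps)
  then have "has_inverse (- (z *\<^sub>C (1 - inverse z *\<^sub>C a)))"
    using has_inverse_one_minus has_inverse_scaleC[OF z(2)] has_inverse_minus by blast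
  moreover have "- (z *\<^sub>C (1 - inverse z *\<^sub>C a)) = a - z *\<^sub>C 1"
    using z(2) by (simp add: scaleC_diff_right scaleC_scaleC)
  ultimately show False using assms by (simp add: spectrum_iff)
qed

text \<open>If \<open>c\<close> inverts \<open>1 - x y\<close>, then \<open>1 + y c x\<close> inverts \<open>1 - y x\<close>.\<close>

lemma has_inverse_one_minus_swap:
  assumes "has_inverse (1 - x * y)" shows "has_inverse (1 - y * x)"
proof -
  obtain c where c: "(1 - x * y) * c = 1" "c * (1 - x * y) = 1"
    using assms unfolding has_inverse_def inverse_of_def by auto
  have c1: "x * y * c = c - 1" and c2: "c * x * y = c - 1"
    using c by (simp_all add: algebra_simps)
  have "y * x * (y * c * x) = y * (x * y * c) * x"
       "(y * c * x) * (y * x) = y * (c * x * y) * x" by (simp_all add: mult.assoc)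
  then have "inverse_of (1 - y * x) (1 + y * c * x)"
    unfolding inverse_of_def c1 c2 by (simp add: algebra_simps)
  then show ?thesis using has_inverse_def by blast
qed

lemma spectrum_mult_swap:
  assumes "z \<in> spectrum (x * y)" "z \<noteq> 0" shows "z \<in> spectrum (y * x)"
proof -
  have *: "z *\<^sub>C (1 - (inverse z *\<^sub>C u) * v) = - (u * v - z *\<^sub>C 1)" for u v :: 'a
    using assms(2) by (simp add: scaleC_diff_right mult_scaleC_left scaleC_scaleC)
  have "has_inverse (x * y - z *\<^sub>C 1)" if "has_inverse (y * x - z *\<^sub>C 1)"
  proof -
    have "has_inverse (1 - (inverse z *\<^sub>C y) * x)"
      using that *[of y x] has_inverse_scaleC[OF assms(2)] has_inverse_minus by metis
    then have "has_inverse (1 - x * (inverse z *\<^sub>C y))" by (rule has_inverse_one_minus_swap)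
    then have "has_inverse (1 - (inverse z *\<^sub>C x) * y)"
      by (simp add: mult_scaleC_left mult_scaleC_right)
    then show ?thesis
      using *[of x y] has_inverse_scaleC[OF assms(2)] has_inverse_minus by metis
  qed
  then show ?thesis using assms(1) by (auto simp: spectrum_iff)
qed

lemma cstar_norm_square: "self_adjoint h \<Longrightarrow> norm (h * h) = (norm h)\<^sup>2"
  using cstar_identity[of h] by (simp add: self_adjoint_def)

text \<open>Adding \<open>i t\<close> shifts a spectral value \<open>u + i v\<close> of \<open>a\<close> up by \<open>t\<close>, while
  \<open>\<parallel>a + i t\<parallel>\<^sup>2 = \<parallel>a\<^sup>2 + t\<^sup>2\<parallel> \<le> \<parallel>a\<parallel>\<^sup>2 + t\<^sup>2\<close>; a summand \<open>2 v t\<close> with \<open>v \<noteq> 0\<close> would break this for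
  suitable \<open>t\<close>.\<close>

lemma spectrum_real:
  assumes sa: "self_adjoint (a::'a::cstar_algebra)" and z: "z \<in> spectrum a"
  shows "Im z = 0"
proof (rule ccontr)
  assume v: "Im z \<noteq> 0"
  have le: "(Re z)\<^sup>2 + (Im z)\<^sup>2 + 2 * Im z * t \<le> (norm a)\<^sup>2" for t :: real
  proof -
    let ?c = "\<i> * complex_of_real t"
    let ?b = "a + ?c *\<^sub>C 1"
    have "?b - (z + ?c) *\<^sub>C 1 = a - z *\<^sub>C 1" by (simp add: scaleC_add_left)
    then have "z + ?c \<in> spectrum ?b" using z by (simp only: spectrum_iff simp_thms)
    then have "cmod (z + ?c) \<le> norm ?b" by (rule spectrum_le_norm)
    then have "(cmod (z + ?c))\<^sup>2 \<le> (norm ?b)\<^sup>2" by (simp add: power_mono)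
    also have "\<dots> = norm (?b\<^sup>\<star> * ?b)" by (simp add: cstar_identity)
    also have "?b\<^sup>\<star> * ?b = a * a + (t\<^sup>2) *\<^sub>R 1"
      using sa by (simp add: self_adjoint_def star_add star_scaleC scaleR_scaleC algebra_simps
          mult_scaleC_left mult_scaleC_right scaleC_scaleC scaleC_diff_right power2_eq_square)
    also have "norm (a * a + (t\<^sup>2) *\<^sub>R 1) \<le> norm (a * a) + t\<^sup>2"
      by (rule order_trans[OF norm_triangle_ineq]) simp
    also have "norm (a * a) = (norm a)\<^sup>2" using sa by (rule cstar_norm_square)
    finally have "(cmod (z + ?c))\<^sup>2 \<le> (norm a)\<^sup>2 + t\<^sup>2" by simp
    moreover have "(cmod (z + ?c))\<^sup>2 = (Re z)\<^sup>2 + (Im z + t)\<^sup>2" by (simp add: cmod_power2)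
    ultimately show ?thesis by (simp add: power2_sum)
  qed
  define t where "t = ((norm a)\<^sup>2 + 1) / (2 * Im z)"
  have "2 * Im z * t = (norm a)\<^sup>2 + 1" using v by (simp add: t_def)
  with le[of t] show False
    by (smt (verit) zero_le_power2)
qed

section \<open>The norm of a self-adjoint element is attained on its spectrum\<close>

lemma continuous_on_resolvent:
  assumes x: "norm (x::'a::cstar_algebra) \<le> 1"
    and R: "\<And>z. z \<in> S \<Longrightarrow> inverse_of (1 - z *\<^sub>C x) (R z)"
  shows "continuous_on S R"
proof (unfold continuous_on_iff, intro ballI allI impI)
  fix z and e :: real assume z: "z \<in> S" and e: "e > 0"
  define K where "K = norm (R z) + 1"
  have K: "K \<ge> 1" "norm (R z) \<le> K" by (simp_all add: K_def)
  define d where "d = min (1 / (2 * K)) (e / (2 * K\<^sup>2))"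
  have "dist (R w) (R z) < e" if w: "w \<in> S" and dw: "dist w z < d" for w
  proof -
    let ?y = "(w - z) *\<^sub>C x"
    have ny: "norm ?y \<le> dist w z"
      using x by (simp add: norm_scaleC dist_norm mult_left_le)
    have "R w - R z = R w * ((1 - z *\<^sub>C x) * R z) - (R w * (1 - w *\<^sub>C x)) * R z"
      using R[OF z] R[OF w] by (simp add: inverse_of_def)
    also have "\<dots> = R w * ?y * R z"
      by (simp add: algebra_simps scaleC_diff_left)
    finally have eq: "R w - R z = R w * ?y * R z" .
    have n: "norm (R w - R z) \<le> norm (R w) * dist w z * K"
      unfolding eq
      by (intro order_trans[OF norm_mult_ineq] mult_mono order_trans[OF norm_mult_ineq] ny K)
        (use K in auto)
    have "dist w z * K \<le> 1 / 2"
      using dw K by (simp add: d_def field_simps)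
    then have "norm (R w) * (dist w z * K) \<le> norm (R w) * (1 / 2)"
      by (intro mult_left_mono) auto
    then have "norm (R w) \<le> norm (R w) * (1/2) + K"
      using n K norm_triangle_ineq2[of "R w" "R z"] by (simp add: mult.assoc)
    then have "norm (R w) \<le> 2 * K" by simp
    then have "norm (R w - R z) \<le> 2 * K * dist w z * K"
      by (intro order_trans[OF n] mult_right_mono) (use K in auto)
    also have "\<dots> = dist w z * (2 * K\<^sup>2)" by (simp add: power2_eq_square)
    also have "\<dots> < e"
      using dw K by (simp add: d_def pos_less_divide_eq)
    finally show ?thesis by (simp add: dist_norm)
  qed
  moreover have "d > 0" using K e by (simp add: d_def)
  ultimately show "\<exists>d>0. \<forall>w\<in>S. dist w z < d \<longrightarrow> dist (R w) (R z) < e" by blast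
qed

text \<open>Since \<open>2 (1 - y\<^sup>2)\<^sup>-\<^sup>1 = (1 - y)\<^sup>-\<^sup>1 + (1 + y)\<^sup>-\<^sup>1\<close> and \<open>- (z x)\<^bsup>2^k\<^esup> = (\<zeta> z x)\<^bsup>2^k\<^esup>\<close> for a suitable root
  of unity \<open>\<zeta>\<close>, the inverse of \<open>1 - (z x)\<^bsup>2^k\<^esup>\<close> is an average of resolvents on the circle through \<open>z\<close>.
  A bound on the variation of the resolvent between the circles of radius \<open>t\<close> and \<open>1\<close> therefore
  passes to these inverses with the same constant for all \<open>k\<close>.\<close>

lemma resolvent_dyadic_average:
  assumes R: "\<And>z. cmod z \<le> 1 \<Longrightarrow> inverse_of (1 - z *\<^sub>C x) (R z)"
    and t: "0 \<le> t" "t \<le> 1"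
    and close: "\<And>z. cmod z = 1 \<Longrightarrow> norm (R z - R (of_real t * z)) \<le> e"
  shows "cmod z = 1 \<Longrightarrow> \<exists>F G. inverse_of (1 - (z *\<^sub>C x) ^ (2 ^ k)) F \<and>
           inverse_of (1 - ((of_real t * z) *\<^sub>C x) ^ (2 ^ k)) G \<and> norm (F - G) \<le> e"
proof (induction k arbitrary: z)
  case 0
  have "cmod (of_real t * z) \<le> 1" using t 0 by (simp add: norm_mult)
  then show ?case using R[of z] R[of "of_real t * z"] close[OF 0] 0 by auto
next
  case (Suc k)
  define \<zeta> where "\<zeta> = cis (pi / 2 ^ k)"
  have "\<zeta> ^ (2 ^ k) = cis (real (2 ^ k) * (pi / 2 ^ k))" unfolding \<zeta>_def by (rule Complex.DeMoivre)
  then have \<zeta>: "\<zeta> ^ (2 ^ k) = -1" by simp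
  have half: "inverse_of (1 - y * y) ((1/2) *\<^sub>R (f1 + f2))"
    if "inverse_of (1 - y) f1" "inverse_of (1 + y) f2" for y f1 f2 :: 'a
  proof -
    have y: "1 - y * y = (1 + y) * (1 - y)" "1 - y * y = (1 - y) * (1 + y)"
      by (simp_all add: algebra_simps)
    have "(1 - y * y) * f1 = 1 + y" "(1 - y * y) * f2 = 1 - y"
      using that unfolding inverse_of_def by (metis y mult.assoc mult.right_neutral)+
    then have "(1 - y * y) * (f1 + f2) = 2" by (simp add: distrib_left)
    moreover have "f1 * (1 - y * y) = 1 + y" "f2 * (1 - y * y) = 1 - y"
      using that unfolding inverse_of_def by (metis y mult.assoc mult.left_neutral)+
    then have "(f1 + f2) * (1 - y * y) = 2" by (simp add: distrib_right)
    moreover have two: "(2::'a) = 2 *\<^sub>R 1" by (simp add: scaleR_conv_of_real)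
    have "(1/2) *\<^sub>R (2::'a) = 1" by (subst two) simp
    ultimately show ?thesis by (simp add: inverse_of_def)
  qed
  have sq: "y ^ (2 ^ Suc k) = y ^ (2 ^ k) * y ^ (2 ^ k)" for y :: 'a
    by (simp add: power_add[symmetric] mult_2)
  have rot: "1 - ((s * (\<zeta> * z)) *\<^sub>C x) ^ (2 ^ k) = 1 + ((s * z) *\<^sub>C x) ^ (2 ^ k)" for s
    by (simp add: scaleC_power power_mult_distrib \<zeta>)
  obtain F1 G1 where 1: "inverse_of (1 - (z *\<^sub>C x) ^ (2 ^ k)) F1"
    "inverse_of (1 - ((of_real t * z) *\<^sub>C x) ^ (2 ^ k)) G1" "norm (F1 - G1) \<le> e"
    using Suc.IH[OF Suc.prems] by blast
  have "cmod (\<zeta> * z) = 1" using Suc.prems by (simp add: norm_mult \<zeta>_def)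
  from Suc.IH[OF this, unfolded rot rot[of 1, unfolded mult_1_left]] obtain F2 G2 where 2: "inverse_of (1 + (z *\<^sub>C x) ^ (2 ^ k)) F2"
    "inverse_of (1 + ((of_real t * z) *\<^sub>C x) ^ (2 ^ k)) G2" "norm (F2 - G2) \<le> e"
    by blast
  have "(1/2) *\<^sub>R (F1 + F2) - (1/2) *\<^sub>R (G1 + G2) = (1/2) *\<^sub>R ((F1 - G1) + (F2 - G2))"
    by (simp add: algebra_simps)
  then have "norm ((1/2) *\<^sub>R (F1 + F2) - (1/2) *\<^sub>R (G1 + G2)) \<le> e"
    using norm_triangle_ineq[of "F1 - G1" "F2 - G2"] 1(3) 2(3) by simp
  then show ?case unfolding sq using half[OF 1(1) 2(1)] half[OF 1(2) 2(2)] by blast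
qed

text \<open>The resolvent is uniformly continuous on the closed disc, so \<open>(1 - x\<^bsup>2^k\<^esup>)\<^sup>-\<^sup>1\<close> is close to
  \<open>(1 - (t x)\<^bsup>2^k\<^esup>)\<^sup>-\<^sup>1\<close> for some \<open>t < 1\<close> and all \<open>k\<close>; the latter tends to \<open>1\<close>. This is Rickart's route
  to the spectral radius, which avoids Liouville's theorem.\<close>

lemma dyadic_power_small:
  assumes x: "norm (x::'a::cstar_algebra) \<le> 1"
    and inv: "\<And>z. cmod z = 1 \<Longrightarrow> has_inverse (1 - z *\<^sub>C x)"
  shows "\<exists>k. norm (x ^ (2 ^ k)) < 1"
proof -
  have "has_inverse (1 - z *\<^sub>C x)" if "cmod z \<le> 1" for z
  proof (cases "cmod z = 1")
    case False
    have "norm (z *\<^sub>C x) \<le> cmod z" using x by (simp add: norm_scaleC mult_left_le)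
    then show ?thesis using has_inverse_one_minus False that by force
  qed (rule inv)
  then have "\<forall>z. \<exists>y. cmod z \<le> 1 \<longrightarrow> inverse_of (1 - z *\<^sub>C x) y"
    unfolding has_inverse_def by blast
  then obtain R where R: "\<And>z. cmod z \<le> 1 \<Longrightarrow> inverse_of (1 - z *\<^sub>C x) (R z)" by metis
  have "continuous_on (cball 0 1) R"
    using R by (intro continuous_on_resolvent[OF x]) auto
  then have "uniformly_continuous_on (cball 0 1) R"
    by (rule compact_uniformly_continuous) simp
  then obtain d where d: "d > 0" "\<And>z w. cmod z \<le> 1 \<Longrightarrow> cmod w \<le> 1 \<Longrightarrow> dist w z < d
      \<Longrightarrow> dist (R w) (R z) < 1 / 12"
    unfolding uniformly_continuous_on_def by (auto dest!: spec[of _ "1/12"])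
  define t where "t = max 0 (1 - d / 2)"
  have t: "0 \<le> t" "t < 1" "1 - t < d" using d(1) by (auto simp: t_def)
  have close: "norm (R z - R (of_real t * z)) \<le> 1 / 12" if "cmod z = 1" for z
  proof -
    have "z - of_real t * z = of_real (1 - t) * z" by (simp add: algebra_simps)
    then have "dist z (of_real t * z) < d"
      using t that by (simp add: dist_norm norm_mult del: of_real_diff)
    then show ?thesis
      using d(2)[of "of_real t * z" z] t that by (simp add: dist_norm norm_mult)
  qed
  obtain n where n: "t ^ n < 1 / 4"
    using real_arch_pow_inv[of "1/4" t] t by auto
  have "t ^ (2 ^ n) \<le> t ^ n" using t by (intro power_decreasing) (auto simp: less_imp_le)
  then have tn: "t ^ (2 ^ n) < 1 / 4" using n by simp
  let ?y = "x ^ (2 ^ n)" and ?w = "(of_real t *\<^sub>C x) ^ (2 ^ n)"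
  obtain F G where F: "inverse_of (1 - ?y) F" and G: "inverse_of (1 - ?w) G"
      and FG: "norm (F - G) \<le> 1 / 12"
    using resolvent_dyadic_average[OF R t(1) less_imp_le[OF t(2)] close, of 1 n] by auto
  have "norm ?w \<le> (norm (of_real t *\<^sub>C x)) ^ (2 ^ n)" by (rule norm_power_ineq)
  also have "\<dots> \<le> t ^ (2 ^ n)"
    using x t by (intro power_mono) (auto simp: norm_scaleC mult_left_le)
  finally have w: "norm ?w \<le> 1 / 4" using tn by simp
  have G1: "G - 1 = ?w * G" using G by (simp add: inverse_of_def algebra_simps)
  have wG: "norm (?w * G) \<le> 1 / 4 * norm G"
    by (rule order_trans[OF norm_mult_ineq]) (intro mult_right_mono w; simp)
  have "norm G \<le> norm (G - 1) + 1" using norm_triangle_ineq[of "G - 1" 1] by simp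
  with wG G1 have "norm G \<le> 4 / 3" by simp
  with wG G1 have "norm (G - 1) \<le> 1 / 3" by simp
  then have F1: "norm (F - 1) \<le> 5 / 12"
    using norm_triangle_ineq[of "F - G" "G - 1"] FG by simp
  have "?y = (F - 1) * (1 - ?y)" using F by (simp add: inverse_of_def algebra_simps)
  then have "norm ?y \<le> norm (F - 1) * norm (1 - ?y)" by (metis norm_mult_ineq)
  also have "\<dots> \<le> 5 / 12 * (1 + norm ?y)"
    using norm_triangle_ineq4[of 1 ?y] by (intro mult_mono F1) auto
  finally have "norm ?y < 1" by simp
  then show ?thesis by blast
qed

lemma norm_dyadic_power:
  "self_adjoint h \<Longrightarrow> norm (h ^ (2 ^ k)) = norm h ^ (2 ^ k)"
proof (induction k)
  case (Suc k)
  have sq: "y ^ (2 ^ Suc k) = y ^ (2 ^ k) * y ^ (2 ^ k)" for y :: 'a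
    by (simp add: power_add[symmetric] mult_2)
  show ?case
    unfolding sq using Suc cstar_norm_square[OF self_adjoint_power[OF Suc.prems, of "2 ^ k"]]
    by (simp add: power2_eq_square power_add[symmetric] mult_2)
qed simp

lemma spectrum_attains_norm:
  assumes sa: "self_adjoint (a::'a::cstar_algebra)"
  shows "\<exists>z\<in>spectrum a. cmod z = norm a"
proof (cases "a = 0")
  case True
  have "\<not> has_inverse (0::'a)" by (simp add: has_inverse_def inverse_of_def)
  then have "0 \<in> spectrum a" using True by (simp add: spectrum_iff)
  then show ?thesis using True by force
next
  case False
  define x where "x = (1 / norm a) *\<^sub>R a"
  have x: "norm x = 1" "self_adjoint x"
    using False sa by (simp_all add: x_def self_adjoint_scaleR)
  have "\<not> (\<exists>k. norm (x ^ (2 ^ k)) < 1)" using x by (simp add: norm_dyadic_power)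
  with dyadic_power_small[of x] x obtain z where z: "cmod z = 1" "\<not> has_inverse (1 - z *\<^sub>C x)"
    by auto
  let ?l = "of_real (norm a) / z"
  have nz: "z \<noteq> 0" "of_real (norm a) \<noteq> (0::complex)" using z False by auto
  have "- ((z / of_real (norm a)) *\<^sub>C (a - ?l *\<^sub>C 1)) = 1 - z *\<^sub>C x"
    using nz by (simp add: scaleC_diff_right scaleC_scaleC x_def scaleR_scaleC)
  then have "\<not> has_inverse (a - ?l *\<^sub>C 1)"
    using z nz has_inverse_scaleC[of "z / of_real (norm a)" "a - ?l *\<^sub>C 1"]
      has_inverse_minus by (metis divide_eq_0_iff)
  then have "?l \<in> spectrum a" by (simp add: spectrum_iff)
  moreover have "cmod ?l = norm a" using z by (simp add: norm_divide)
  ultimately show ?thesis by blast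
qed

section \<open>Polynomials of an element\<close>

lemma poly_at_eq_sum:
  assumes "degree p \<le> n"
  shows "poly_at p (a::'a::cstar_algebra) = (\<Sum>i\<le>n. coeff p i *\<^sub>C a ^ i)"
  unfolding poly_at_def using assms
  by (intro sum.mono_neutral_left) (auto simp: coeff_eq_0)

lemma poly_at_0 [simp]: "poly_at 0 (a::'a::cstar_algebra) = 0"
  by (simp add: poly_at_def)

lemma poly_at_add: "poly_at (p + q) (a::'a::cstar_algebra) = poly_at p a + poly_at q a"
proof -
  let ?n = "max (degree p) (degree q)"
  have "poly_at (p + q) a = (\<Sum>i\<le>?n. coeff (p + q) i *\<^sub>C a ^ i)"
    by (intro poly_at_eq_sum degree_add_le) auto
  also have "\<dots> = (\<Sum>i\<le>?n. coeff p i *\<^sub>C a ^ i) + (\<Sum>i\<le>?n. coeff q i *\<^sub>C a ^ i)"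
    by (simp add: scaleC_add_left sum.distrib)
  also have "\<dots> = poly_at p a + poly_at q a"
    by (simp add: poly_at_eq_sum[symmetric])
  finally show ?thesis .
qed

lemma poly_at_smult: "poly_at (smult c p) (a::'a::cstar_algebra) = c *\<^sub>C poly_at p a"
proof -
  have "poly_at (smult c p) a = (\<Sum>i\<le>degree p. coeff (smult c p) i *\<^sub>C a ^ i)"
    by (intro poly_at_eq_sum degree_smult_le)
  then show ?thesis by (simp add: poly_at_def scaleC_sum_right scaleC_scaleC)
qed

lemma poly_at_diff: "poly_at (p - q) (a::'a::cstar_algebra) = poly_at p a - poly_at q a"
  using poly_at_add[of p "- q" a] poly_at_smult[of "-1" q a] by simp

lemma poly_at_pCons:
  "poly_at (pCons c p) (a::'a::cstar_algebra) = c *\<^sub>C 1 + a * poly_at p a"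
proof -
  have "poly_at (pCons c p) a = (\<Sum>i\<le>Suc (degree p). coeff (pCons c p) i *\<^sub>C a ^ i)"
    by (intro poly_at_eq_sum degree_pCons_le)
  also have "\<dots> = c *\<^sub>C 1 + (\<Sum>i\<le>degree p. coeff p i *\<^sub>C a ^ Suc i)"
    by (simp add: sum.atMost_Suc_shift del: sum.atMost_Suc)
  finally show ?thesis by (simp add: poly_at_def sum_distrib_left mult_scaleC_right)
qed

lemma poly_at_mult: "poly_at (p * q) (a::'a::cstar_algebra) = poly_at p a * poly_at q a"
proof (induction p)
  case (pCons c p)
  have "poly_at (pCons c p * q) a = c *\<^sub>C poly_at q a + a * poly_at (p * q) a"
    by (simp add: poly_at_add poly_at_smult poly_at_pCons)
  also have "\<dots> = poly_at (pCons c p) a * poly_at q a"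
    by (simp add: pCons.IH poly_at_pCons distrib_right mult_scaleC_left mult.assoc)
  finally show ?case .
qed simp

lemma poly_at_commute:
  assumes "x * a = a * (x::'a::cstar_algebra)" shows "x * poly_at p a = poly_at p a * x"
proof (induction p)
  case (pCons c p)
  have "x * (a * poly_at p a) = a * poly_at p a * x"
    using pCons.IH assms by (metis mult.assoc)
  then show ?case
    by (simp add: poly_at_pCons distrib_left distrib_right mult_scaleC_left mult_scaleC_right)
qed simp

lemma star_poly_at:
  assumes "self_adjoint a" shows "(poly_at p a)\<^sup>\<star> = poly_at (map_poly cnj p) a"
proof -
  have "poly_at (map_poly cnj p) a = (\<Sum>i\<le>degree p. cnj (coeff p i) *\<^sub>C a ^ i)"
    using poly_at_eq_sum[of "map_poly cnj p" "degree p" a]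
    by (simp add: coeff_map_poly degree_map_poly)
  then show ?thesis
    using assms by (simp add: poly_at_def star_sum star_scaleC star_power self_adjoint_def)
qed

text \<open>Factor \<open>q\<close> over the complex numbers: if no root of \<open>q\<close> lies in the spectrum, every factor
  of \<open>q(a)\<close> is invertible.\<close>

lemma has_inverse_poly_at:
  assumes "q \<noteq> 0" "\<And>z. poly q z = 0 \<Longrightarrow> z \<notin> spectrum a"
  shows "has_inverse (poly_at q a)"
  using assms
proof (induction "degree q" arbitrary: q)
  case 0
  then obtain c where q: "q = [:c:]" using degree_eq_zeroE by metis
  with \<open>q \<noteq> 0\<close> have "c \<noteq> 0" by simp
  then show ?case using q by (simp add: poly_at_pCons has_inverse_scaleC has_inverse_one)
next
  case (Suc n)
  obtain z where z: "poly q z = 0" using alg_closed_imp_poly_has_root[of q] Suc.hyps(2) by auto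
  then obtain r where r: "q = [:- z, 1:] * r" using poly_eq_0_iff_dvd by (metis dvdE)
  with Suc.prems have "r \<noteq> 0" by auto
  moreover have "degree q = Suc (degree r)"
    using \<open>r \<noteq> 0\<close> by (simp add: r degree_mult_eq del: mult_pCons_left)
  ultimately have "has_inverse (poly_at r a)"
    using Suc r by (intro Suc.hyps(1)) auto
  moreover have "has_inverse (a - z *\<^sub>C 1)" using Suc.prems(2)[OF z] by (simp add: spectrum_iff)
  moreover have "poly_at q a = (a - z *\<^sub>C 1) * poly_at r a"
    unfolding r poly_at_mult by (simp add: poly_at_pCons)
  ultimately show ?case using has_inverse_mult by simp
qed

lemma spectrum_poly_at:
  assumes sa: "self_adjoint a" and w: "w \<in> spectrum (poly_at p a)"
  shows "\<exists>z\<in>spectrum a. w = poly p z"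
proof (cases "p = [:w:]")
  case True
  then show ?thesis using spectrum_attains_norm[OF sa] by auto
next
  case False
  have "\<not> has_inverse (poly_at (p - [:w:]) a)"
    using w by (simp add: spectrum_iff poly_at_diff poly_at_pCons)
  then show ?thesis using has_inverse_poly_at[of "p - [:w:]" a] False by force
qed

text \<open>The element \<open>p(a)\<^sup>\<star> p(a)\<close> is again a polynomial of \<open>a\<close>, and it is self-adjoint, so by the
  \<open>C\<^sup>*\<close>-identity \<open>\<parallel>p(a)\<parallel>\<^sup>2\<close> is attained on its spectrum.\<close>

lemma norm_poly_at_le:
  assumes sa: "self_adjoint a" and le: "\<And>z. z \<in> spectrum a \<Longrightarrow> cmod (poly p z) \<le> C"
  shows "norm (poly_at p a) \<le> C"
proof -
  let ?q = "map_poly cnj p * p"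
  have q: "poly_at ?q a = (poly_at p a)\<^sup>\<star> * poly_at p a"
    using sa by (simp add: poly_at_mult star_poly_at)
  then obtain w where "w \<in> spectrum (poly_at ?q a)" "cmod w = norm (poly_at ?q a)"
    using spectrum_attains_norm self_adjoint_star_mult by metis
  then obtain z where z: "z \<in> spectrum a" "cmod (poly ?q z) = norm (poly_at ?q a)"
    using spectrum_poly_at[OF sa] by blast
  have "cnj z = z" using spectrum_real[OF sa z(1)] by (simp add: complex_eq_iff)
  then have "cmod (poly ?q z) = (cmod (poly p z))\<^sup>2"
    by (simp add: norm_mult power2_eq_square)
  moreover have "norm (poly_at ?q a) = (norm (poly_at p a))\<^sup>2" by (simp add: q cstar_identity)
  ultimately have "norm (poly_at p a) = cmod (poly p z)"
    using z by (simp add: power2_eq_iff_nonneg)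
  then show ?thesis using le[OF z(1)] by simp
qed

section \<open>Continuous functional calculus\<close>

text \<open>A relational form of the calculus, witnessed by one sequence of polynomials. It is easier to
  combine than the definite description, to which it is equivalent for self-adjoint elements as
  soon as one such sequence exists.\<close>

definition cfc_limit :: "'a::cstar_algebra \<Rightarrow> (complex \<Rightarrow> complex) \<Rightarrow> 'a \<Rightarrow> bool" where
  "cfc_limit a f b \<longleftrightarrow> (\<exists>p. uniform_limit (spectrum a) (\<lambda>n. poly (p n)) f sequentially \<and>
     (\<lambda>n. poly_at (p n) a) \<longlonglongrightarrow> b)"

lemma poly_at_uniform_limit_zero:
  assumes sa: "self_adjoint a"
    and p: "uniform_limit (spectrum a) (\<lambda>n. poly (p n)) f sequentially"
    and q: "uniform_limit (spectrum a) (\<lambda>n. poly (q n)) f sequentially"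
  shows "(\<lambda>n. poly_at (p n) a - poly_at (q n) a) \<longlonglongrightarrow> 0"
proof (rule LIMSEQ_I)
  fix e :: real assume e: "e > 0"
  then have e4: "e / 4 > 0" by simp
  have "eventually (\<lambda>n. norm (poly_at (p n) a - poly_at (q n) a) \<le> e / 2) sequentially"
    using uniform_limitD[OF p e4] uniform_limitD[OF q e4]
  proof eventually_elim
    case (elim n)
    have "cmod (poly (p n - q n) z) \<le> e / 2" if "z \<in> spectrum a" for z
    proof -
      have "dist (poly (p n) z) (poly (q n) z) < e / 4 + e / 4"
        using elim that by (intro dist_triangle_less_add[of _ "f z"]) (auto simp: dist_commute)
      then show ?thesis by (simp add: dist_norm)
    qed
    from norm_poly_at_le[OF sa this] show ?case
      by (simp add: poly_at_diff)
  qed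
  then have "eventually (\<lambda>n. norm (poly_at (p n) a - poly_at (q n) a - 0) < e) sequentially"
    by eventually_elim (use e in auto)
  then show "\<exists>no. \<forall>n\<ge>no. norm (poly_at (p n) a - poly_at (q n) a - 0) < e"
    by (simp add: eventually_sequentially)
qed

lemma cfc_eq:
  assumes sa: "self_adjoint a" and b: "cfc_limit a f b"
  shows "cfc f a = b"
proof -
  obtain p where p: "uniform_limit (spectrum a) (\<lambda>n. poly (p n)) f sequentially"
    "(\<lambda>n. poly_at (p n) a) \<longlonglongrightarrow> b" using b cfc_limit_def by blast
  show ?thesis unfolding cfc_def
  proof (rule the_equality, intro allI impI)
    fix q assume q: "uniform_limit (spectrum a) (\<lambda>n. poly (q n)) f sequentially"
    from tendsto_add[OF poly_at_uniform_limit_zero[OF sa q p(1)] p(2)]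
    show "(\<lambda>n. poly_at (q n) a) \<longlonglongrightarrow> b" by simp
  next
    fix c assume "\<forall>p. uniform_limit (spectrum a) (\<lambda>n. poly (p n)) f sequentially \<longrightarrow>
      (\<lambda>n. poly_at (p n) a) \<longlonglongrightarrow> c"
    then show "c = b" using p LIMSEQ_unique by blast
  qed
qed

lemma cfc_limit_exists:
  assumes sa: "self_adjoint a"
    and p: "uniform_limit (spectrum a) (\<lambda>n. poly (p n)) f sequentially"
  shows "\<exists>b. cfc_limit a f b"
proof -
  have "Cauchy (\<lambda>n. poly_at (p n) a)"
  proof (rule CauchyI)
    fix e :: real assume e: "e > 0"
    obtain N where N: "\<And>n z. n \<ge> N \<Longrightarrow> z \<in> spectrum a \<Longrightarrow> dist (poly (p n) z) (f z) < e / 4"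
      using uniform_limitD[OF p, of "e/4"] e by (auto simp: eventually_sequentially)
    have "norm (poly_at (p m) a - poly_at (p n) a) < e" if "m \<ge> N" "n \<ge> N" for m n
    proof -
      have "cmod (poly (p m - p n) z) \<le> e / 2" if "z \<in> spectrum a" for z
      proof -
        have "dist (poly (p m) z) (poly (p n) z) < e / 4 + e / 4"
          using N \<open>m \<ge> N\<close> \<open>n \<ge> N\<close> that
          by (intro dist_triangle_less_add[of _ "f z"]) (auto simp: dist_commute)
        then show ?thesis by (simp add: dist_norm)
      qed
      from norm_poly_at_le[OF sa this] show ?thesis using e by (simp add: poly_at_diff)
    qed
    then show "\<exists>M. \<forall>m\<ge>M. \<forall>n\<ge>M. norm (poly_at (p m) a - poly_at (p n) a) < e" by blast
  qed
  then show ?thesis unfolding cfc_limit_def using p Cauchy_convergent convergent_def by blast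
qed

lemma cfc_limit_one: "cfc_limit (a::'a::cstar_algebra) (\<lambda>_. 1) 1"
  unfolding cfc_limit_def
  by (rule exI[of _ "\<lambda>_. [:1:]"]) (simp add: poly_at_pCons uniform_limit_iff)

lemma cfc_limit_id: "cfc_limit (a::'a::cstar_algebra) (\<lambda>z. z) a"
  unfolding cfc_limit_def
  by (rule exI[of _ "\<lambda>_. [:0, 1:]"]) (simp add: poly_at_pCons uniform_limit_iff)

lemma cfc_limit_cong:
  assumes "cfc_limit a f b" "\<And>z. z \<in> spectrum a \<Longrightarrow> f z = g z"
  shows "cfc_limit a g b"
proof -
  have "uniform_limit (spectrum a) p f sequentially \<longleftrightarrow> uniform_limit (spectrum a) p g sequentially"
    for p by (rule uniform_limit_cong') (use assms(2) in auto)
  with assms(1) show ?thesis unfolding cfc_limit_def by simp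
qed

lemma cfc_limit_mult:
  assumes f: "cfc_limit a f b" and g: "cfc_limit a g c"
    and bd: "bounded (f ` spectrum a)" "bounded (g ` spectrum a)"
  shows "cfc_limit a (\<lambda>z. f z * g z) (b * c)"
proof -
  obtain p q where p: "uniform_limit (spectrum a) (\<lambda>n. poly (p n)) f sequentially"
    "(\<lambda>n. poly_at (p n) a) \<longlonglongrightarrow> b" and q: "uniform_limit (spectrum a) (\<lambda>n. poly (q n)) g sequentially"
    "(\<lambda>n. poly_at (q n) a) \<longlonglongrightarrow> c" using f g cfc_limit_def by metis
  have "(\<lambda>n. poly (p n * q n)) = (\<lambda>n z. poly (p n) z * poly (q n) z)" by (auto simp: fun_eq_iff)
  then have "uniform_limit (spectrum a) (\<lambda>n. poly (p n * q n)) (\<lambda>z. f z * g z) sequentially"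
    using uniform_lim_mult[OF p(1) q(1) bd] by simp
  moreover have "(\<lambda>n. poly_at (p n * q n) a) \<longlonglongrightarrow> b * c"
    using tendsto_mult[OF p(2) q(2)] by (simp add: poly_at_mult)
  ultimately show ?thesis unfolding cfc_limit_def by (intro exI[of _ "\<lambda>n. p n * q n"] conjI)
qed

lemma cfc_limit_self_adjoint:
  assumes sa: "self_adjoint a" and b: "cfc_limit a f b"
    and real: "\<And>z. z \<in> spectrum a \<Longrightarrow> cnj (f z) = f z"
  shows "self_adjoint b"
proof -
  obtain p where p: "uniform_limit (spectrum a) (\<lambda>n. poly (p n)) f sequentially"
    "(\<lambda>n. poly_at (p n) a) \<longlonglongrightarrow> b" using b cfc_limit_def by blast
  have "dist (poly (map_poly cnj (p n)) z) (f z) = dist (poly (p n) z) (f z)"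
    if "z \<in> spectrum a" for n z
  proof -
    have z: "cnj z = z" using spectrum_real[OF sa that] by (simp add: complex_eq_iff)
    have "dist (cnj (poly (p n) z)) (cnj (f z)) = dist (poly (p n) z) (f z)"
      by (simp add: dist_norm flip: complex_cnj_diff)
    then show ?thesis using real[OF that] z by simp
  qed
  then have "uniform_limit (spectrum a) (\<lambda>n. poly (map_poly cnj (p n))) f sequentially"
    using p(1) unfolding uniform_limit_iff by simp
  moreover have "(\<lambda>n. poly_at (map_poly cnj (p n)) a) \<longlonglongrightarrow> b\<^sup>\<star>"
    using tendsto_star[OF p(2)] by (simp add: star_poly_at[OF sa])
  ultimately have "cfc_limit a f (b\<^sup>\<star>)"
    unfolding cfc_limit_def by (intro exI[of _ "\<lambda>n. map_poly cnj (p n)"] conjI)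
  from cfc_eq[OF sa this] cfc_eq[OF sa b] show ?thesis by (simp add: self_adjoint_def)
qed

lemma norm_cfc_limit_le:
  assumes sa: "self_adjoint a" and b: "cfc_limit a f b"
    and le: "\<And>z. z \<in> spectrum a \<Longrightarrow> cmod (f z) \<le> C"
  shows "norm b \<le> C"
proof (rule field_le_epsilon)
  fix e :: real assume e: "e > 0"
  obtain p where p: "uniform_limit (spectrum a) (\<lambda>n. poly (p n)) f sequentially"
    "(\<lambda>n. poly_at (p n) a) \<longlonglongrightarrow> b" using b cfc_limit_def by blast
  have "eventually (\<lambda>n. norm (poly_at (p n) a) \<le> C + e) sequentially"
    using uniform_limitD[OF p(1) e]
  proof eventually_elim
    case (elim n)
    show ?case
    proof (rule norm_poly_at_le[OF sa])
      fix z assume z: "z \<in> spectrum a"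
      then have "cmod (poly (p n) z - f z) < e" using elim by (simp add: dist_norm)
      then show "cmod (poly (p n) z) \<le> C + e"
        using le[OF z] norm_triangle_ineq[of "poly (p n) z - f z" "f z"] by simp
    qed
  qed
  then show "norm b \<le> C + e"
    using tendsto_upperbound[OF tendsto_norm[OF p(2)]] by simp
qed

lemma cfc_limit_commute:
  assumes b: "cfc_limit a f b" and x: "x * a = a * x"
  shows "x * b = b * x"
proof -
  obtain p where p: "(\<lambda>n. poly_at (p n) a) \<longlonglongrightarrow> b" using b cfc_limit_def by blast
  have "(\<lambda>n. poly_at (p n) a * x) \<longlonglongrightarrow> x * b"
    using tendsto_mult_left[OF p, of x] by (simp add: poly_at_commute[OF x])
  moreover have "(\<lambda>n. poly_at (p n) a * x) \<longlonglongrightarrow> b * x" by (intro tendsto_intros p)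
  ultimately show ?thesis by (rule LIMSEQ_unique)
qed

lemma cfc_limit_continuous:
  assumes sa: "self_adjoint a" and r: "\<And>z. z \<in> spectrum a \<Longrightarrow> Re z \<in> {u..v}"
    and f: "continuous_on {u..v} f"
  shows "\<exists>b. cfc_limit a (\<lambda>z. complex_of_real (f (Re z))) b"
proof -
  have "\<exists>p. \<forall>x\<in>{u..v}. cmod (poly p (of_real x) - of_real (f x)) < inverse (Suc n)" for n :: nat
  proof -
    obtain g where g: "real_polynomial_function g"
      "\<And>x. x \<in> {u..v} \<Longrightarrow> \<bar>f x - g x\<bar> < inverse (Suc n)"
      using Stone_Weierstrass_real_polynomial_function[OF _ f, of "inverse (Suc n)"] by auto
    then obtain c m where cm: "g = (\<lambda>x. \<Sum>i\<le>m. c i * x ^ i)"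
      using real_polynomial_function_iff_sum by blast
    have "poly (\<Sum>i\<le>m. monom (of_real (c i)) i) (of_real x) = complex_of_real (g x)" for x
      by (simp add: cm poly_sum poly_monom)
    then have "\<forall>x\<in>{u..v}. cmod (poly (\<Sum>i\<le>m. monom (of_real (c i)) i) (of_real x)
        - of_real (f x)) < inverse (Suc n)"
      using g(2) by (simp add: abs_minus_commute flip: of_real_diff)
    then show ?thesis by blast
  qed
  then obtain p where p: "\<And>n x. x \<in> {u..v} \<Longrightarrow>
      cmod (poly (p n) (of_real x) - of_real (f x)) < inverse (Suc n)" by metis
  have pz: "dist (poly (p n) z) (of_real (f (Re z))) < inverse (Suc n)"
    if "z \<in> spectrum a" for n z
  proof -
    have "of_real (Re z) = z" using spectrum_real[OF sa that] by (simp add: complex_eq_iff)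
    then show ?thesis using p[OF r[OF that], of n] by (simp add: dist_norm)
  qed
  have "uniform_limit (spectrum a) (\<lambda>n. poly (p n)) (\<lambda>z. of_real (f (Re z))) sequentially"
  proof (rule uniform_limitI)
    fix e :: real assume "e > 0"
    then obtain N where "inverse (real (Suc N)) < e" using reals_Archimedean by blast
    moreover have "inverse (real (Suc n)) \<le> inverse (real (Suc N))" if "n \<ge> N" for n
      using that by (intro le_imp_inverse_le) auto
    ultimately have "\<forall>n\<ge>N. \<forall>z\<in>spectrum a. dist (poly (p n) z) (of_real (f (Re z))) < e"
      using pz by (meson order.strict_trans order.strict_trans2)
    then show "\<forall>\<^sub>F n in sequentially. \<forall>z\<in>spectrum a. dist (poly (p n) z) (of_real (f (Re z))) < e"
      unfolding eventually_sequentially by blast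
  qed
  then show ?thesis by (rule cfc_limit_exists[OF sa])
qed

section \<open>Elements with nonnegative spectrum\<close>

definition nonneg_spectrum :: "'a::cstar_algebra \<Rightarrow> bool" where
  "nonneg_spectrum a \<longleftrightarrow> self_adjoint a \<and> (\<forall>z\<in>spectrum a. 0 \<le> Re z)"

lemma spectrum_eq_Re:
  assumes "self_adjoint a" "z \<in> spectrum a" shows "z = of_real (Re z)"
  using spectrum_real[OF assms] by (simp add: complex_eq_iff)

lemma scaleR_one_eq: "r *\<^sub>R (1::'a::cstar_algebra) = of_real r *\<^sub>C 1"
  by (rule scaleR_scaleC)

lemma spectrum_minus:
  assumes "z \<in> spectrum (- a)" shows "- z \<in> spectrum a"
proof -
  have "- a - z *\<^sub>C 1 = - (a - (- z) *\<^sub>C 1)" by simp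
  then show ?thesis using assms has_inverse_minus by (metis spectrum_iff)
qed

lemma nonneg_spectrum_self_adjoint: "nonneg_spectrum a \<Longrightarrow> self_adjoint a"
  by (simp add: nonneg_spectrum_def)

lemma norm_le_if_nonneg_spectrum:
  assumes a: "nonneg_spectrum a" and t: "norm a \<le> t"
  shows "norm (t *\<^sub>R 1 - a) \<le> t"
proof -
  have sa: "self_adjoint a" using a nonneg_spectrum_def by blast
  have "norm (poly_at [:of_real t, -1:] a) \<le> t"
  proof (rule norm_poly_at_le[OF sa])
    fix z assume z: "z \<in> spectrum a"
    have "Re z \<ge> 0" using a z nonneg_spectrum_def by blast
    moreover have "Re z \<le> t"
      using spectrum_le_norm[OF z] complex_Re_le_cmod[of z] t by simp
    moreover have "poly [:of_real t, -1:] z = complex_of_real (t - Re z)"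
      using spectrum_eq_Re[OF sa z] by simp
    ultimately show "cmod (poly [:of_real t, -1:] z) \<le> t" by (simp del: of_real_diff)
  qed
  then show ?thesis by (simp add: poly_at_pCons scaleR_one_eq)
qed

lemma nonneg_spectrum_if_norm_le:
  assumes sa: "self_adjoint a" and t: "norm (t *\<^sub>R 1 - a) \<le> t"
  shows "nonneg_spectrum a"
  unfolding nonneg_spectrum_def
proof (intro conjI ballI sa)
  fix z assume z: "z \<in> spectrum a"
  have "(t *\<^sub>R 1 - a) - (of_real t - z) *\<^sub>C 1 = - (a - z *\<^sub>C 1)"
    by (simp add: scaleR_one_eq scaleC_diff_left)
  then have "of_real t - z \<in> spectrum (t *\<^sub>R 1 - a)"
    using z has_inverse_minus by (metis spectrum_iff)
  then have "cmod (of_real t - z) \<le> t" using spectrum_le_norm t by fastforce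
  then show "0 \<le> Re z" using complex_Re_le_cmod[of "of_real t - z"] by simp
qed

text \<open>For self-adjoint \<open>a\<close> and \<open>t \<ge> \<parallel>a\<parallel>\<close> a nonnegative spectrum means \<open>\<parallel>t - a\<parallel> \<le> t\<close>, a condition
  that the triangle inequality carries over to sums.\<close>

lemma nonneg_spectrum_add:
  assumes a: "nonneg_spectrum a" and b: "nonneg_spectrum b"
  shows "nonneg_spectrum (a + b)"
proof (rule nonneg_spectrum_if_norm_le)
  show "self_adjoint (a + b)" using a b by (simp add: nonneg_spectrum_def self_adjoint_add)
  have "(norm a + norm b) *\<^sub>R 1 - (a + b) = (norm a *\<^sub>R 1 - a) + (norm b *\<^sub>R 1 - b)"
    by (simp add: algebra_simps)
  then show "norm ((norm a + norm b) *\<^sub>R 1 - (a + b)) \<le> norm a + norm b"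
    using norm_triangle_mono norm_le_if_nonneg_spectrum[OF a order_refl]
      norm_le_if_nonneg_spectrum[OF b order_refl] by metis
qed

lemma nonneg_spectrum_poly_at:
  assumes sa: "self_adjoint a" and p: "self_adjoint (poly_at p a)"
    and nn: "\<And>z. z \<in> spectrum a \<Longrightarrow> 0 \<le> Re (poly p z)"
  shows "nonneg_spectrum (poly_at p a)"
  unfolding nonneg_spectrum_def using p nn spectrum_poly_at[OF sa] by blast

lemma nonneg_spectrum_scaleR:
  assumes a: "nonneg_spectrum a" and r: "r \<ge> 0"
  shows "nonneg_spectrum (r *\<^sub>R a)"
proof -
  have "poly_at [:0, of_real r:] a = r *\<^sub>R a"
    by (simp add: poly_at_pCons mult_scaleC_right scaleR_scaleC)
  then show ?thesis
    using nonneg_spectrum_poly_at[of a "[:0, of_real r:]"] a r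
    by (simp add: nonneg_spectrum_def self_adjoint_scaleR)
qed

lemma nonneg_spectrum_square:
  assumes sa: "self_adjoint c" shows "nonneg_spectrum (c * c)"
proof -
  have p: "poly_at [:0, 0, 1:] c = c * c" by (simp add: poly_at_pCons)
  have "0 \<le> Re (poly [:0, 0, 1:] z)" if "z \<in> spectrum c" for z
    using spectrum_real[OF sa that] by simp
  moreover have "self_adjoint (c * c)" using sa by (simp add: self_adjoint_def star_mult)
  ultimately show ?thesis using nonneg_spectrum_poly_at[OF sa, of "[:0, 0, 1:]"] p by simp
qed

lemma nonneg_spectrum_archimedean:
  assumes sa: "self_adjoint a" and e: "\<And>e. e > 0 \<Longrightarrow> nonneg_spectrum (e *\<^sub>R 1 + a)"
  shows "nonneg_spectrum a"
  unfolding nonneg_spectrum_def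
proof (intro conjI ballI sa)
  fix z assume z: "z \<in> spectrum a"
  show "0 \<le> Re z"
  proof (rule field_le_epsilon)
    fix e :: real assume "e > 0"
    have "(e *\<^sub>R 1 + a) - (of_real e + z) *\<^sub>C 1 = a - z *\<^sub>C 1"
      by (simp add: scaleR_one_eq scaleC_add_left)
    then have "of_real e + z \<in> spectrum (e *\<^sub>R 1 + a)" using z by (simp only: spectrum_iff simp_thms)
    then show "0 \<le> Re z + e" using e[OF \<open>e > 0\<close>] by (auto simp: nonneg_spectrum_def)
  qed
qed

section \<open>Powers\<close>

text \<open>The exponent \<open>0\<close> needs its own clause here too, since \<open>0 powr 0 = 0\<close>.\<close>

definition power_fun :: "real \<Rightarrow> complex \<Rightarrow> complex" where
  "power_fun t z = (if t = 0 then 1 else complex_of_real (Re z powr t))"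

lemma cfc_limit_power:
  assumes a: "nonneg_spectrum a" and t: "t \<ge> 0"
  shows "cfc_limit a (power_fun t) (cstar_power a t)"
proof (cases "t = 0")
  case True
  then show ?thesis using cfc_limit_one by (simp add: power_fun_def[abs_def] cstar_power_def)
next
  case False
  have sa: "self_adjoint a" using a nonneg_spectrum_def by blast
  have "Re z \<in> {0..norm a}" if "z \<in> spectrum a" for z
    using a that spectrum_le_norm[OF that] complex_Re_le_cmod[of z] by (simp add: nonneg_spectrum_def)
  moreover have "continuous_on {0..norm a} (\<lambda>x. x powr t)"
    using t False by (intro continuous_on_powr' continuous_intros) auto
  ultimately obtain b where "cfc_limit a (\<lambda>z. complex_of_real (Re z powr t)) b"
    using cfc_limit_continuous[OF sa] by blast
  then show ?thesis
    using cfc_eq[OF sa] False by (simp add: power_fun_def[abs_def] cstar_power_def)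
qed

lemma cstar_power_zero [simp]: "cstar_power a 0 = 1"
  by (simp add: cstar_power_def)

lemma cstar_power_one:
  assumes a: "nonneg_spectrum a" shows "cstar_power a 1 = a"
proof -
  have sa: "self_adjoint a" using a nonneg_spectrum_def by blast
  have "power_fun 1 z = z" if "z \<in> spectrum a" for z
    using spectrum_eq_Re[OF sa that] a that by (simp add: power_fun_def nonneg_spectrum_def)
  then have "cfc_limit a (\<lambda>z. z) (cstar_power a 1)"
    by (intro cfc_limit_cong[OF cfc_limit_power[OF a]]) auto
  then show ?thesis using cfc_eq[OF sa] cfc_limit_id by metis
qed

lemma bounded_power_fun:
  assumes a: "nonneg_spectrum a" and t: "t \<ge> 0"
  shows "bounded (power_fun t ` spectrum a)"
proof (rule boundedI)
  fix w assume "w \<in> power_fun t ` spectrum a"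
  then obtain z where z: "z \<in> spectrum a" "w = power_fun t z" by blast
  have "Re z \<le> norm a" "0 \<le> Re z"
    using a z spectrum_le_norm[OF z(1)] complex_Re_le_cmod[of z] by (auto simp: nonneg_spectrum_def)
  then have "Re z powr t \<le> norm a powr t" using t by (intro powr_mono2) auto
  then show "cmod w \<le> max 1 (norm a powr t)" using z by (auto simp: power_fun_def)
qed

lemma cstar_power_add:
  assumes a: "nonneg_spectrum a" and st: "s \<ge> 0" "t \<ge> 0"
  shows "cstar_power a s * cstar_power a t = cstar_power a (s + t)"
proof -
  have sa: "self_adjoint a" using a nonneg_spectrum_def by blast
  have "cfc_limit a (\<lambda>z. power_fun s z * power_fun t z) (cstar_power a s * cstar_power a t)"
    using a st by (intro cfc_limit_mult cfc_limit_power bounded_power_fun)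
  moreover have "power_fun s z * power_fun t z = power_fun (s + t) z" for z
    using st by (auto simp: power_fun_def powr_add)
  ultimately have "cfc_limit a (power_fun (s + t)) (cstar_power a s * cstar_power a t)" by simp
  then show ?thesis using cfc_eq[OF sa] cfc_limit_power[OF a] st by (metis add_nonneg_nonneg)
qed

lemma self_adjoint_cstar_power:
  assumes a: "nonneg_spectrum a" and t: "t \<ge> 0"
  shows "self_adjoint (cstar_power a t)"
  using a by (intro cfc_limit_self_adjoint[OF _ cfc_limit_power[OF a t]])
    (auto simp: power_fun_def nonneg_spectrum_def)

lemma cstar_power_commute:
  assumes "nonneg_spectrum a" "t \<ge> 0" "x * a = a * x"
  shows "x * cstar_power a t = cstar_power a t * x"
  using cfc_limit_commute[OF cfc_limit_power] assms by blast

lemma norm_cstar_power_le: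
  assumes a: "nonneg_spectrum a" and t: "0 \<le> t" "t \<le> 1" and L: "norm a \<le> L" "1 \<le> L"
  shows "norm (cstar_power a t) \<le> L"
proof -
  have sa: "self_adjoint a" using a nonneg_spectrum_def by blast
  show ?thesis
  proof (rule norm_cfc_limit_le[OF sa cfc_limit_power[OF a t(1)]])
    fix z assume z: "z \<in> spectrum a"
    have "Re z \<le> L" "0 \<le> Re z"
      using a z L spectrum_le_norm[OF z] complex_Re_le_cmod[of z] by (auto simp: nonneg_spectrum_def)
    then have "Re z powr t \<le> L powr t" using t by (intro powr_mono2) auto
    also have "\<dots> \<le> L powr 1" using t L by (intro powr_mono) auto
    finally show "cmod (power_fun t z) \<le> L" using L by (auto simp: power_fun_def)
  qed
qed

section \<open>Positive elements\<close>

lemma eq_zero_if_nonneg_spectrum_minus: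
  assumes "nonneg_spectrum a" "nonneg_spectrum (- a)" shows "a = 0"
proof -
  have sa: "self_adjoint a" using assms(1) nonneg_spectrum_def by blast
  obtain z where z: "z \<in> spectrum a" "cmod z = norm a" using spectrum_attains_norm[OF sa] by blast
  have "- z \<in> spectrum (- a)" using spectrum_minus[of z "- a"] z by simp
  then have "Re z = 0" using assms z by (force simp: nonneg_spectrum_def)
  then have "z = 0" using spectrum_eq_Re[OF sa z(1)] by simp
  then show ?thesis using z by simp
qed

text \<open>The classical argument: let \<open>c = b\<^sup>\<star> b\<close>, let \<open>m = \<bar>c\<bar>\<close> be the square root of \<open>c\<^sup>2\<close>, and let
  \<open>n = m - c\<close> be twice the negative part. With \<open>d = b n\<close> one gets \<open>d\<^sup>\<star> d = n c n = - n m n\<close>, so \<open>d\<^sup>\<star> d\<close> and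
  then \<open>d d\<^sup>\<star>\<close> have nonpositive spectrum, whereas \<open>d\<^sup>\<star> d + d d\<^sup>\<star>\<close> is a sum of squares of
  self-adjoint elements. This forces \<open>d\<^sup>\<star> d = 0\<close> and finally \<open>n = 0\<close>.\<close>

lemma nonneg_spectrum_star_mult: "nonneg_spectrum ((b::'a::cstar_algebra)\<^sup>\<star> * b)"
proof -
  define c where "c = b\<^sup>\<star> * b"
  have sc: "self_adjoint c" by (simp add: c_def self_adjoint_star_mult)
  have cc: "nonneg_spectrum (c * c)" by (rule nonneg_spectrum_square[OF sc])
  define k where "k = cstar_power (c * c) (1/4)"
  define m where "m = k * k"
  have sk: "self_adjoint k" by (simp add: k_def self_adjoint_cstar_power cc)
  have m: "m = cstar_power (c * c) (1/2)"
    using cstar_power_add[OF cc, of "1/4" "1/4"] by (simp add: m_def k_def)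
  have mm: "m * m = c * c"
    using cstar_power_add[OF cc, of "1/2" "1/2"] cstar_power_one[OF cc] by (simp add: m)
  have ck: "c * k = k * c"
    unfolding k_def by (rule cstar_power_commute[OF cc]) (simp_all add: mult.assoc)
  have mc: "c * m = m * c" unfolding m_def using ck by (metis mult.assoc)
  have nm: "nonneg_spectrum m" unfolding m_def by (rule nonneg_spectrum_square[OF sk])
  define n where "n = m - c"
  have sn: "self_adjoint n"
    unfolding n_def using nonneg_spectrum_self_adjoint[OF nm] sc by (rule self_adjoint_diff)
  have kn: "k * n = n * k" by (simp add: n_def m_def algebra_simps ck)
  have nc: "n * c = - (n * m)" by (simp add: n_def algebra_simps mm mc)
  define d where "d = b * n"
  have "n * m * n = k * n * (k * n)" unfolding m_def using kn by (metis mult.assoc)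
  moreover have "self_adjoint (k * n)"
    using sk sn kn by (simp add: self_adjoint_def star_mult)
  ultimately have nmn: "nonneg_spectrum (n * m * n)" using nonneg_spectrum_square by metis
  have "d\<^sup>\<star> * d = n * c * n" using sn by (simp add: d_def c_def self_adjoint_def star_mult mult.assoc)
  then have dd: "d\<^sup>\<star> * d = - (n * m * n)" by (simp add: nc)
  have dd': "nonneg_spectrum (- (d * d\<^sup>\<star>))" unfolding nonneg_spectrum_def
  proof (intro conjI ballI)
    show "self_adjoint (- (d * d\<^sup>\<star>))" by (simp add: self_adjoint_def star_mult star_star)
    fix z assume z: "z \<in> spectrum (- (d * d\<^sup>\<star>))"
    show "0 \<le> Re z"
    proof (cases "z = 0")
      case False
      then have "- z \<in> spectrum (d\<^sup>\<star> * d)" using spectrum_mult_swap[OF spectrum_minus[OF z]] by simp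
      then have "z \<in> spectrum (n * m * n)" using spectrum_minus[of "- z" "n * m * n"] dd by simp
      then show ?thesis using nmn nonneg_spectrum_def by blast
    qed simp
  qed
  define u where "u = d + d\<^sup>\<star>"
  define w where "w = \<i> *\<^sub>C (d - d\<^sup>\<star>)"
  have su: "self_adjoint u" by (simp add: u_def self_adjoint_def star_add star_star add.commute)
  have sw: "self_adjoint w"
    by (simp add: w_def self_adjoint_def star_scaleC star_diff star_star scaleC_diff_right)
  have "u * u + w * w = 2 *\<^sub>R (d\<^sup>\<star> * d + d * d\<^sup>\<star>)"
    by (simp add: u_def w_def mult_scaleC_left mult_scaleC_right scaleC_scaleC
        scaleC_diff_right algebra_simps scaleR_2)
  then have "(1/2) *\<^sub>R (u * u + w * w) + - (d * d\<^sup>\<star>) = d\<^sup>\<star> * d" by simp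
  then have "nonneg_spectrum (d\<^sup>\<star> * d)"
    using nonneg_spectrum_add[OF nonneg_spectrum_scaleR[OF nonneg_spectrum_add[OF
        nonneg_spectrum_square[OF su] nonneg_spectrum_square[OF sw]], of "1/2"] dd'] by simp
  then have "n * m * n = 0" using eq_zero_if_nonneg_spectrum_minus[OF nmn] dd by simp
  have nn: "n * n = 2 *\<^sub>R (n * m)" using nc by (simp add: n_def right_diff_distrib scaleR_2)
  have "n ^ (2 ^ 2) = (n * n) * n * n" by (simp add: numeral_eq_Suc mult.assoc)
  also have "(n * n) * n = 2 *\<^sub>R (n * m * n)" by (simp add: nn)
  also have "\<dots> = 0" by (simp add: \<open>n * m * n = 0\<close>)
  finally have "norm n ^ (2 ^ 2) = 0" using norm_dyadic_power[OF sn, of 2] by simp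
  then have "n = 0" by simp
  then show ?thesis using nm by (simp add: n_def c_def)
qed

lemma positive_element_iff_nonneg_spectrum: "positive_element a \<longleftrightarrow> nonneg_spectrum a"
proof
  assume a: "nonneg_spectrum a"
  let ?s = "cstar_power a (1/2)"
  have "a = ?s\<^sup>\<star> * ?s"
    using cstar_power_add[OF a, of "1/2" "1/2"] cstar_power_one[OF a]
      self_adjoint_cstar_power[OF a, of "1/2"] by (simp add: self_adjoint_def)
  then show "positive_element a" unfolding positive_element_def by blast
qed (auto simp: positive_element_def nonneg_spectrum_star_mult)

lemma positive_star_mult: "positive_element (b\<^sup>\<star> * b)"
  unfolding positive_element_def by blast

lemma positive_mult_star: "positive_element (b * b\<^sup>\<star>)"
  using positive_star_mult[of "b\<^sup>\<star>"] by (simp add: star_star)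

lemma positive_element_add:
  "positive_element a \<Longrightarrow> positive_element b \<Longrightarrow> positive_element (a + b)"
  by (simp add: positive_element_iff_nonneg_spectrum nonneg_spectrum_add)

lemma positive_element_scaleR: "positive_element a \<Longrightarrow> r \<ge> 0 \<Longrightarrow> positive_element (r *\<^sub>R a)"
  by (simp add: positive_element_iff_nonneg_spectrum nonneg_spectrum_scaleR)

lemma positive_one: "positive_element 1"
  using positive_star_mult[of 1] by simp

lemma positive_diff_if_norm_le:
  assumes "self_adjoint a" "norm a \<le> t" shows "positive_element (t *\<^sub>R 1 - a)"
proof -
  have "norm (t *\<^sub>R 1 - (t *\<^sub>R 1 - a)) \<le> t" using assms by simp
  then show ?thesis
    unfolding positive_element_iff_nonneg_spectrum using assms
    by (intro nonneg_spectrum_if_norm_le self_adjoint_diff self_adjoint_scaleR self_adjoint_one)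
qed

section \<open>Tracial two-positive maps\<close>

lemma positive_conj:
  assumes "positive_element a" shows "positive_element (x\<^sup>\<star> * a * x)"
proof -
  obtain b where "a = b\<^sup>\<star> * b" using assms positive_element_def by blast
  then have "x\<^sup>\<star> * a * x = (b * x)\<^sup>\<star> * (b * x)" by (simp add: star_mult mult.assoc)
  then show ?thesis using positive_star_mult by metis
qed

lemma mat_star_mult_nth:
  "(mat_star N ** N) $ i $ j = (N $ 1 $ i)\<^sup>\<star> * N $ 1 $ j + (N $ 2 $ i)\<^sup>\<star> * N $ 2 $ j"
  by (simp add: mat_star_def matrix_matrix_mult_def sum_2)

text \<open>The \<open>2 \<times> 2\<close> matrix with entries \<open>X\<^sup>\<star> X\<close>, \<open>X\<^sup>\<star> Y\<close>, \<open>Y\<^sup>\<star> X\<close>, \<open>Y\<^sup>\<star> Y\<close> is \<open>N\<^sup>\<star> N\<close> for \<open>N\<close> with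
  first row \<open>(X, Y)\<close> and second row \<open>0\<close>.\<close>

lemma two_positive_gram:
  fixes \<Phi> :: "'a::cstar_algebra \<Rightarrow> 'b::cstar_algebra"
  assumes "two_positive \<Phi>"
  obtains K :: "'b^2^2" where
    "\<Phi> (X\<^sup>\<star> * X) = (K $ 1 $ 1)\<^sup>\<star> * K $ 1 $ 1 + (K $ 2 $ 1)\<^sup>\<star> * K $ 2 $ 1"
    "\<Phi> (X\<^sup>\<star> * Y) = (K $ 1 $ 1)\<^sup>\<star> * K $ 1 $ 2 + (K $ 2 $ 1)\<^sup>\<star> * K $ 2 $ 2"
    "\<Phi> (Y\<^sup>\<star> * X) = (K $ 1 $ 2)\<^sup>\<star> * K $ 1 $ 1 + (K $ 2 $ 2)\<^sup>\<star> * K $ 2 $ 1"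
    "\<Phi> (Y\<^sup>\<star> * Y) = (K $ 1 $ 2)\<^sup>\<star> * K $ 1 $ 2 + (K $ 2 $ 2)\<^sup>\<star> * K $ 2 $ 2"
proof -
  define N :: "'a^2^2" where "N = (\<chi> i j. if i = 1 then (if j = 1 then X else Y) else 0)"
  let ?M = "mat_star N ** N"
  have N: "N $ 1 $ 1 = X" "N $ 1 $ 2 = Y" "N $ 2 $ j = 0" for j by (simp_all add: N_def)
  have "positive_matrix ?M" unfolding positive_matrix_def by blast
  then have "positive_matrix (\<chi> i j. \<Phi> (?M $ i $ j))"
    using assms unfolding two_positive_def by blast
  then obtain K where K: "(\<chi> i j. \<Phi> (?M $ i $ j)) = mat_star K ** K"
    unfolding positive_matrix_def by blast
  have "\<Phi> (?M $ i $ j) = (K $ 1 $ i)\<^sup>\<star> * K $ 1 $ j + (K $ 2 $ i)\<^sup>\<star> * K $ 2 $ j" for i j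
    using arg_cong[OF K, of "\<lambda>M. M $ i $ j"] by (simp add: mat_star_mult_nth)
  note e = this[unfolded mat_star_mult_nth]
  show thesis
    using e[of 1 1] e[of 1 2] e[of 2 1] e[of 2 2] by (intro that[of K]) (simp_all add: N)
qed

lemma two_positive_positive:
  fixes \<Phi> :: "'a::cstar_algebra \<Rightarrow> 'b::cstar_algebra"
  assumes "two_positive \<Phi>" "positive_element x" shows "positive_element (\<Phi> x)"
proof -
  obtain b where b: "x = b\<^sup>\<star> * b" using assms(2) positive_element_def by blast
  obtain K :: "'b^2^2" where "\<Phi> (b\<^sup>\<star> * b) = (K $ 1 $ 1)\<^sup>\<star> * K $ 1 $ 1 + (K $ 2 $ 1)\<^sup>\<star> * K $ 2 $ 1"
    using two_positive_gram[OF assms(1)] by metis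
  then show ?thesis using b positive_element_add positive_star_mult by metis
qed

text \<open>A Gram matrix \<open>(m\<^sub>i\<^sub>j)\<close> with \<open>m\<^sub>2\<^sub>2 = 1\<close> has the Schur complement \<open>m\<^sub>1\<^sub>1 - m\<^sub>1\<^sub>2 m\<^sub>2\<^sub>1\<close>, which is
  obtained by compressing the matrix with the column \<open>(1, - m\<^sub>2\<^sub>1)\<close>.\<close>

lemma two_positive_schwarz:
  fixes \<Phi> :: "'a::cstar_algebra \<Rightarrow> 'b::cstar_algebra"
  assumes "two_positive \<Phi>" "\<Phi> (Y\<^sup>\<star> * Y) = 1"
  shows "positive_element (\<Phi> (X\<^sup>\<star> * X) - \<Phi> (X\<^sup>\<star> * Y) * \<Phi> (Y\<^sup>\<star> * X))"
proof -
  obtain K :: "'b^2^2" where K: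
    "\<Phi> (X\<^sup>\<star> * X) = (K $ 1 $ 1)\<^sup>\<star> * K $ 1 $ 1 + (K $ 2 $ 1)\<^sup>\<star> * K $ 2 $ 1"
    "\<Phi> (X\<^sup>\<star> * Y) = (K $ 1 $ 1)\<^sup>\<star> * K $ 1 $ 2 + (K $ 2 $ 1)\<^sup>\<star> * K $ 2 $ 2"
    "\<Phi> (Y\<^sup>\<star> * X) = (K $ 1 $ 2)\<^sup>\<star> * K $ 1 $ 1 + (K $ 2 $ 2)\<^sup>\<star> * K $ 2 $ 1"
    "\<Phi> (Y\<^sup>\<star> * Y) = (K $ 1 $ 2)\<^sup>\<star> * K $ 1 $ 2 + (K $ 2 $ 2)\<^sup>\<star> * K $ 2 $ 2"
    by (rule two_positive_gram[OF assms(1)])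
  define m where "m = \<Phi> (Y\<^sup>\<star> * X)"
  have ms: "m\<^sup>\<star> = \<Phi> (X\<^sup>\<star> * Y)" by (simp add: m_def K star_add star_mult star_star)
  define a where "a = K $ 1 $ 1 - K $ 1 $ 2 * m"
  define c where "c = K $ 2 $ 1 - K $ 2 $ 2 * m"
  have "a\<^sup>\<star> * a + c\<^sup>\<star> * c = \<Phi> (X\<^sup>\<star> * X) - \<Phi> (X\<^sup>\<star> * Y) * m - m\<^sup>\<star> * \<Phi> (Y\<^sup>\<star> * X)
      + m\<^sup>\<star> * \<Phi> (Y\<^sup>\<star> * Y) * m"
    unfolding a_def c_def K by (simp add: star_diff star_mult algebra_simps)
  also have "\<dots> = \<Phi> (X\<^sup>\<star> * X) - \<Phi> (X\<^sup>\<star> * Y) * \<Phi> (Y\<^sup>\<star> * X)"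
    by (simp add: assms(2) ms flip: m_def)
  finally show ?thesis using positive_element_add[OF positive_star_mult positive_star_mult] by metis
qed

context
  fixes \<Phi> :: "'a::cstar_algebra \<Rightarrow> 'b::cstar_algebra"
  assumes linear: "complex_linear \<Phi>"
begin

lemma linear_map_add: "\<Phi> (x + y) = \<Phi> x + \<Phi> y"
  and linear_map_scaleC: "\<Phi> (c *\<^sub>C x) = c *\<^sub>C \<Phi> x"
  using linear unfolding complex_linear_def by blast+

lemma linear_map_scaleR: "\<Phi> (r *\<^sub>R x) = r *\<^sub>R \<Phi> x"
  by (simp add: scaleR_scaleC linear_map_scaleC)

lemma linear_map_diff: "\<Phi> (x - y) = \<Phi> x - \<Phi> y"
  using linear_map_add[of x "(-1) *\<^sub>C y"] linear_map_scaleC[of "-1" y] by simp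

end

section \<open>The interpolating function of the skew information\<close>

definition wyd_correlation ::
    "('a::cstar_algebra \<Rightarrow> 'b::cstar_algebra) \<Rightarrow> 'a \<Rightarrow> 'a \<Rightarrow> real \<Rightarrow> 'b" where
  "wyd_correlation \<Phi> \<rho> A t = \<Phi> (cstar_power \<rho> (1 - t) * A * cstar_power \<rho> t * A)"

context
  fixes \<Phi> :: "'a::cstar_algebra \<Rightarrow> 'b::cstar_algebra" and \<rho> A :: 'a
  assumes linear: "complex_linear \<Phi>"
    and tracial: "tracial \<Phi>"
    and two_positive: "two_positive \<Phi>"
    and nonneg: "nonneg_spectrum \<rho>"
    and self_adjoint: "self_adjoint A"
begin

private abbreviation "P \<equiv> cstar_power \<rho>"
private abbreviation "g \<equiv> wyd_correlation \<Phi> \<rho> A"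

private lemma trace: "\<Phi> (x * y) = \<Phi> (y * x)"
  using tracial unfolding tracial_def by blast

private lemma P_mult: "s \<ge> 0 \<Longrightarrow> t \<ge> 0 \<Longrightarrow> P s * P t = P (s + t)"
  by (rule cstar_power_add[OF nonneg])

private lemma P_mult_assoc: "s \<ge> 0 \<Longrightarrow> t \<ge> 0 \<Longrightarrow> P s * (P t * x) = P (s + t) * x"
  by (simp add: P_mult flip: mult.assoc)

private lemma star_P: "t \<ge> 0 \<Longrightarrow> (P t)\<^sup>\<star> = P t"
  using self_adjoint_cstar_power[OF nonneg] by (simp add: self_adjoint_def)

private lemma star_A: "A\<^sup>\<star> = A"
  using self_adjoint by (simp add: self_adjoint_def)

lemma wyd_correlation_symmetric: "g (1 - t) = g t"
  unfolding wyd_correlation_def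
  using trace[of "P (1 - t) * A" "P t * A"] by (simp add: mult.assoc)

lemma wyd_correlation_zero: "g 0 = \<Phi> (\<rho> * A * A)"
  by (simp add: wyd_correlation_def cstar_power_one[OF nonneg])

text \<open>The second difference at \<open>s\<close> of the scalar function \<open>t \<mapsto> x\<^bsup>1-t\<^esup> y\<^bsup>t\<^esup>\<close> with step \<open>d\<close> is
  \<open>x\<^bsup>1-s-2d\<^esup> y\<^bsup>s\<^esup> (x\<^bsup>d\<^esup> - y\<^bsup>d\<^esup>)\<^sup>2\<close>, the square of \<open>x\<^bsup>(1-s-2d)/2\<^esup> (x\<^bsup>d\<^esup> - y\<^bsup>d\<^esup>) y\<^bsup>s/2\<^esup>\<close>. Replacing \<open>x\<close> by
  multiplication of \<open>A\<close> by \<open>\<rho>\<close> from the left and \<open>y\<close> by multiplication from the right turns this root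
  into an element \<open>X\<close>, and by the trace property the second difference of \<open>g\<close> is \<open>\<Phi>(X X\<^sup>\<star>)\<close>.\<close>

lemma wyd_correlation_midpoint_convex:
  assumes s: "0 \<le> s" and d: "0 \<le> d" and sd: "s + 2 * d \<le> 1"
  shows "positive_element (g s + g (s + 2 * d) - 2 *\<^sub>R g (s + d))"
proof -
  define b where "b = 1 - s - 2 * d"
  have b: "b \<ge> 0" using sd by (simp add: b_def)
  define Z where "Z = P d * A - A * P d"
  define X where "X = P (b / 2) * (Z * P (s / 2))"
  have Zs: "Z\<^sup>\<star> = A * P d - P d * A"
    using d by (simp add: Z_def star_diff star_mult star_P star_A)
  have "X * X\<^sup>\<star> = P (b / 2) * (Z * (P (s / 2) * P (s / 2)) * Z\<^sup>\<star> * P (b / 2))"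
    using s b by (simp add: X_def star_mult star_P mult.assoc)
  then have "\<Phi> (X * X\<^sup>\<star>) = \<Phi> ((Z * P s * Z\<^sup>\<star> * P (b / 2)) * P (b / 2))"
    using s by (simp add: P_mult trace)
  also have "\<dots> = \<Phi> ((Z * P s * Z\<^sup>\<star>) * P b)" using b by (simp add: mult.assoc P_mult)
  also have "\<dots> = \<Phi> (P b * (Z * P s * Z\<^sup>\<star>))" by (rule trace)
  also have "P b * (Z * P s * Z\<^sup>\<star>) =
      (P b * P d) * A * P s * A * P d - (P b * P d) * A * (P s * P d) * A
      - P b * A * (P d * P s) * A * P d + P b * A * (P d * P s * P d) * A"
    unfolding Zs unfolding Z_def by (simp add: algebra_simps)
  also have "\<Phi> \<dots> = \<Phi> ((P b * P d * A * P s * A) * P d) - \<Phi> (P b * P d * A * (P s * P d) * A)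
      - \<Phi> ((P b * A * (P d * P s) * A) * P d) + \<Phi> (P b * A * (P d * P s * P d) * A)"
    by (simp add: linear_map_add[OF linear] linear_map_diff[OF linear])
  also have "\<Phi> ((P b * P d * A * P s * A) * P d) = g s"
  proof -
    have e: "1 - s = d + (b + d)" by (simp add: b_def)
    have "\<Phi> ((P b * P d * A * P s * A) * P d) = \<Phi> (P (d + (b + d)) * A * P s * A)"
      unfolding trace[of _ "P d"] using b d by (simp add: mult.assoc P_mult_assoc)
    then show ?thesis unfolding wyd_correlation_def e .
  qed
  also have "\<Phi> (P b * P d * A * (P s * P d) * A) = g (s + d)"
  proof -
    have e: "1 - (s + d) = b + d" by (simp add: b_def)
    show ?thesis unfolding wyd_correlation_def e using b d s by (simp add: P_mult)
  qed
  also have "\<Phi> ((P b * A * (P d * P s) * A) * P d) = g (s + d)"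
  proof -
    have e: "1 - (s + d) = d + b" by (simp add: b_def)
    have "\<Phi> ((P b * A * (P d * P s) * A) * P d) = \<Phi> (P (d + b) * A * P (s + d) * A)"
      unfolding trace[of _ "P d"] using b d s
      by (simp add: mult.assoc P_mult_assoc P_mult add.commute)
    then show ?thesis unfolding wyd_correlation_def e .
  qed
  also have "\<Phi> (P b * A * (P d * P s * P d) * A) = g (s + 2 * d)"
  proof -
    have e: "1 - (s + 2 * d) = b" "s + 2 * d = d + s + d" by (simp_all add: b_def)
    show ?thesis unfolding wyd_correlation_def e(1) unfolding e(2) using d s by (simp add: P_mult)
  qed
  finally have "\<Phi> (X * X\<^sup>\<star>) = g s + g (s + 2 * d) - 2 *\<^sub>R g (s + d)"
    by (simp add: scaleR_2)
  then show ?thesis using two_positive_positive[OF two_positive positive_mult_star] by metis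
qed

lemma wyd_correlation_half_le:
  assumes t: "0 \<le> t" "t \<le> 1" shows "positive_element (g t - g (1 / 2))"
proof -
  have *: "positive_element (g t - g (1 / 2))" if "0 \<le> t" "t \<le> 1 / 2" for t
  proof -
    have "g (t + 2 * (1 / 2 - t)) = g t" using wyd_correlation_symmetric[of t] by simp
    then have "positive_element (g t + g t - 2 *\<^sub>R g (1 / 2))"
      using wyd_correlation_midpoint_convex[of t "1 / 2 - t"] that by simp
    then have "positive_element ((1 / 2) *\<^sub>R (g t + g t - 2 *\<^sub>R g (1 / 2)))"
      by (rule positive_element_scaleR) simp
    then show ?thesis by (simp add: scaleR_diff_right flip: scaleR_2)
  qed
  show ?thesis
    using *[of t] *[of "1 - t"] t wyd_correlation_symmetric[of t] by (cases "t \<le> 1 / 2") auto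
qed

text \<open>A crude bound, uniform in \<open>t\<close>: since \<open>\<rho>\<^sup>t \<le> L\<close> for \<open>L = max 1 \<parallel>\<rho>\<parallel>\<close>, the two powers of \<open>\<rho>\<close> in
  \<open>g(t)\<close> can be replaced by \<open>L\<close>, which gives \<open>g(t) \<le> L\<^sup>2 \<Phi>(A\<^sup>2)\<close>, while \<open>g(0) \<ge> 0\<close>.\<close>

lemma wyd_correlation_bounded:
  "\<exists>c\<ge>0. \<forall>t\<in>{0..1}. positive_element (c *\<^sub>R 1 + (g 0 - g t))"
proof -
  define L where "L = max 1 (norm \<rho>)"
  have L: "L \<ge> 1" "norm \<rho> \<le> L" by (simp_all add: L_def)
  have LP: "positive_element (L *\<^sub>R 1 - P t)" if "0 \<le> t" "t \<le> 1" for t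
    using that L by (intro positive_diff_if_norm_le self_adjoint_cstar_power nonneg norm_cstar_power_le)
  have pos: "positive_element (\<Phi> x)" if "positive_element x" for x
    using two_positive_positive[OF two_positive that] .
  have g0: "positive_element (g 0)"
  proof -
    have "\<Phi> (((A * P (1/2))\<^sup>\<star>) * (A * P (1/2))) = \<Phi> ((P (1/2) * (A * A)) * P (1/2))"
      by (simp add: star_mult star_P star_A mult.assoc)
    also have "\<dots> = \<Phi> ((P (1/2) * P (1/2)) * A * A)"
      unfolding trace[of _ "P (1/2)"] by (simp add: mult.assoc)
    also have "\<dots> = g 0" by (simp add: P_mult wyd_correlation_def)
    finally show ?thesis using pos[OF positive_star_mult] by metis
  qed
  have sq: "positive_element (norm (\<Phi> (A * A)) *\<^sub>R 1 - \<Phi> (A * A))"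
    using pos[OF positive_star_mult[of A]]
    by (intro positive_diff_if_norm_le) (simp_all add: star_A positive_element_iff_nonneg_spectrum
        nonneg_spectrum_self_adjoint)
  have main: "positive_element (L\<^sup>2 *\<^sub>R \<Phi> (A * A) - g t)" if t: "0 \<le> t" "t \<le> 1" for t
  proof -
    define Q where "Q = P ((1 - t) / 2)"
    have QQ: "Q * Q = P (1 - t)" using t by (simp add: Q_def P_mult)
    have sQ: "Q\<^sup>\<star> = Q" using t by (simp add: Q_def star_P)
    have "\<Phi> ((A * Q)\<^sup>\<star> * (L *\<^sub>R 1 - P t) * (A * Q)) =
        L *\<^sub>R \<Phi> ((Q * (A * A)) * Q) - \<Phi> ((Q * (A * P t * A)) * Q)"
      by (simp add: star_mult sQ star_A algebra_simps linear_map_diff[OF linear]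
          linear_map_scaleR[OF linear])
    also have "\<dots> = L *\<^sub>R \<Phi> ((Q * Q) * A * A) - \<Phi> ((Q * Q) * A * P t * A)"
      unfolding trace[of _ Q] by (simp add: mult.assoc)
    also have "\<dots> = L *\<^sub>R \<Phi> (P (1 - t) * A * A) - g t" by (simp add: QQ wyd_correlation_def)
    finally have 1: "positive_element (L *\<^sub>R \<Phi> (P (1 - t) * A * A) - g t)"
      using pos[OF positive_conj[OF LP[OF t]]] by metis
    have LP': "positive_element (L *\<^sub>R 1 - P (1 - t))" using LP t by simp
    have "\<Phi> (A\<^sup>\<star> * (L *\<^sub>R 1 - P (1 - t)) * A) = L *\<^sub>R \<Phi> (A * A) - \<Phi> (A * (P (1 - t) * A))"
      by (simp add: star_A algebra_simps linear_map_diff[OF linear] linear_map_scaleR[OF linear])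
    also have "\<dots> = L *\<^sub>R \<Phi> (A * A) - \<Phi> (P (1 - t) * A * A)"
      unfolding trace[of A "P (1 - t) * A"] by (simp add: mult.assoc)
    finally have "positive_element (L *\<^sub>R \<Phi> (A * A) - \<Phi> (P (1 - t) * A * A))"
      using pos[OF positive_conj[OF LP']] by metis
    then have "positive_element (L *\<^sub>R (L *\<^sub>R \<Phi> (A * A) - \<Phi> (P (1 - t) * A * A)))"
      using L by (intro positive_element_scaleR) auto
    from positive_element_add[OF this 1] show ?thesis
      by (simp add: scaleR_diff_right power2_eq_square)
  qed
  define c where "c = L\<^sup>2 * norm (\<Phi> (A * A))"
  have "positive_element (c *\<^sub>R 1 + (g 0 - g t))" if "0 \<le> t" "t \<le> 1" for t
  proof -
    have "positive_element (L\<^sup>2 *\<^sub>R (norm (\<Phi> (A * A)) *\<^sub>R 1 - \<Phi> (A * A)) + (L\<^sup>2 *\<^sub>R \<Phi> (A * A) - g t)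
        + g 0)"
      by (intro positive_element_add positive_element_scaleR sq main that g0) simp
    then show ?thesis by (simp add: c_def algebra_simps)
  qed
  moreover have "c \<ge> 0" by (simp add: c_def)
  ultimately show ?thesis by auto
qed

text \<open>For \<open>t \<le> 1/2\<close> midpoint convexity between \<open>0\<close> and \<open>2 t\<close> turns a bound \<open>g(2 t) - g(0) \<le> c\<close> into
  \<open>g(t) - g(0) \<le> c / 2\<close>, and symmetry covers \<open>t \<ge> 1/2\<close>. Hence every bound that is uniform in
  \<open>t\<close> can be halved.\<close>

lemma wyd_correlation_le_zero:
  assumes t: "0 \<le> t" "t \<le> 1" shows "positive_element (g 0 - g t)"
proof -
  obtain c where c: "c \<ge> 0" "\<And>t. 0 \<le> t \<Longrightarrow> t \<le> 1 \<Longrightarrow> positive_element (c *\<^sub>R 1 + (g 0 - g t))"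
    using wyd_correlation_bounded by auto
  have halve: "positive_element ((c / 2 ^ n) *\<^sub>R 1 + (g 0 - g t))" if "0 \<le> t" "t \<le> 1" for n t
    using that
  proof (induction n arbitrary: t)
    case 0
    then show ?case using c by simp
  next
    case (Suc n)
    have *: "positive_element ((c / 2 ^ Suc n) *\<^sub>R 1 + (g 0 - g t))" if "0 \<le> t" "t \<le> 1 / 2" for t
    proof -
      have "positive_element ((g 0 + g (2 * t) - 2 *\<^sub>R g t) + ((c / 2 ^ n) *\<^sub>R 1 + (g 0 - g (2 * t))))"
      proof (rule positive_element_add)
        show "positive_element (g 0 + g (2 * t) - 2 *\<^sub>R g t)"
          using wyd_correlation_midpoint_convex[of 0 t] that by simp
        show "positive_element ((c / 2 ^ n) *\<^sub>R 1 + (g 0 - g (2 * t)))"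
          using that by (intro Suc.IH) auto
      qed
      also have "(g 0 + g (2 * t) - 2 *\<^sub>R g t) + ((c / 2 ^ n) *\<^sub>R 1 + (g 0 - g (2 * t))) =
          2 *\<^sub>R ((c / 2 ^ Suc n) *\<^sub>R 1 + (g 0 - g t))"
        by (simp add: scaleR_add_right scaleR_diff_right) (simp add: scaleR_2)
      finally have "positive_element ((1 / 2) *\<^sub>R (2 *\<^sub>R ((c / 2 ^ Suc n) *\<^sub>R 1 + (g 0 - g t))))"
        by (rule positive_element_scaleR) simp
      then show ?thesis by simp
    qed
    show ?case
      using *[of t] *[of "1 - t"] Suc.prems wyd_correlation_symmetric[of t]
      by (cases "t \<le> 1 / 2") auto
  qed
  have e: "positive_element (e *\<^sub>R 1 + (g 0 - g t))" if "e > 0" for e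
  proof -
    obtain n where "(1 / 2) ^ n < e / (c + 1)"
      using real_arch_pow_inv[of "e / (c + 1)" "1 / 2"] \<open>e > 0\<close> c(1) by auto
    then have "(c + 1) * (1 / 2) ^ n < e" using c(1) by (simp add: pos_less_divide_eq mult.commute)
    moreover have "c / 2 ^ n \<le> (c + 1) * (1 / 2) ^ n"
      by (simp add: power_one_over divide_simps)
    ultimately have n: "c / 2 ^ n \<le> e" by linarith
    have "positive_element ((e - c / 2 ^ n) *\<^sub>R 1 + ((c / 2 ^ n) *\<^sub>R 1 + (g 0 - g t)))"
      using n by (intro positive_element_add halve t positive_element_scaleR positive_one) auto
    then show ?thesis by (simp add: scaleR_diff_left)
  qed
  have "self_adjoint (1 *\<^sub>R 1 + (g 0 - g t))"
    using e[of 1] by (simp add: positive_element_iff_nonneg_spectrum nonneg_spectrum_self_adjoint)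
  then have "self_adjoint ((1 + (g 0 - g t)) - 1)" by (intro self_adjoint_diff) simp_all
  then show ?thesis
    using e nonneg_spectrum_archimedean[of "g 0 - g t"]
    by (simp add: positive_element_iff_nonneg_spectrum)
qed

text \<open>With \<open>B = \<rho>\<^bsup>1/4\<^esup> A \<rho>\<^bsup>1/4\<^esup>\<close> the trace property gives \<open>\<Phi>(B\<^sup>\<star> B) = g(1/2)\<close> and
  \<open>\<Phi>(B\<^sup>\<star> \<rho>\<^bsup>1/2\<^esup>) = \<Phi>(\<rho> A) = \<Phi>(\<rho>\<^bsup>1/2\<^esup> B)\<close>, so the Schwarz inequality applies.\<close>

lemma wyd_correlation_half_ge:
  assumes "\<Phi> \<rho> = 1"
  shows "positive_element (g (1 / 2) - \<Phi> (\<rho> * A) * \<Phi> (\<rho> * A))"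
proof -
  define Q where "Q = P (1 / 4)"
  have Q: "Q\<^sup>\<star> = Q" "Q * Q = P (1 / 2)" by (simp_all add: Q_def star_P P_mult)
  have PP: "P (1 / 2) * P (1 / 2) = \<rho>" by (simp add: P_mult cstar_power_one[OF nonneg])
  have Q4: "Q * Q * Q * Q = \<rho>" using Q PP by (metis mult.assoc)
  define B where "B = Q * A * Q"
  have B: "B\<^sup>\<star> = B" by (simp add: B_def star_mult Q star_A mult.assoc)
  have S: "(P (1 / 2))\<^sup>\<star> = P (1 / 2)" by (simp add: star_P)
  have 1: "\<Phi> (B * B) = g (1 / 2)"
  proof -
    have "\<Phi> (B * B) = \<Phi> ((Q * A * (Q * Q) * A) * Q)" by (simp add: B_def mult.assoc)
    also have "\<dots> = \<Phi> ((Q * Q) * A * (Q * Q) * A)" unfolding trace[of _ Q] by (simp add: mult.assoc)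
    finally show ?thesis by (simp add: Q wyd_correlation_def)
  qed
  have 2: "\<Phi> (P (1 / 2) * B) = \<Phi> (\<rho> * A)"
  proof -
    have "\<Phi> (P (1 / 2) * B) = \<Phi> ((Q * Q * Q * A) * Q)" by (simp add: B_def mult.assoc flip: Q(2))
    also have "\<dots> = \<Phi> ((Q * Q * Q * Q) * A)" unfolding trace[of _ Q] by (simp add: mult.assoc)
    finally show ?thesis by (simp add: Q4)
  qed
  have 3: "\<Phi> (B * P (1 / 2)) = \<Phi> (\<rho> * A)" using 2 by (simp add: trace)
  show ?thesis
    using two_positive_schwarz[OF two_positive, of "P (1 / 2)" B] assms
    by (simp add: B S PP 1 2 3)
qed

end

theorem mainTheorem3:
  fixes \<Phi> :: "'a::cstar_algebra \<Rightarrow> 'b::cstar_algebra"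
    and \<rho> :: 'a and \<alpha> :: real and A :: 'a
  assumes "complex_linear \<Phi>" and "tracial \<Phi>" and "two_positive \<Phi>"
    and "density_operator \<Phi> \<rho>"
    and "\<alpha> \<in> {0..1}"
    and "self_adjoint A"
  shows "0 \<preceq> wyd_skew_info \<alpha> \<Phi> \<rho> A \<and>
         wyd_skew_info \<alpha> \<Phi> \<rho> A \<preceq> wy_skew_info \<Phi> \<rho> A \<and>
         wy_skew_info \<Phi> \<rho> A \<preceq> gen_variance \<Phi> \<rho> A"
proof -
  have \<rho>: "nonneg_spectrum \<rho>" "\<Phi> \<rho> = 1"
    using assms(4) by (simp_all add: density_operator_def positive_element_iff_nonneg_spectrum)
  have A: "A\<^sup>\<star> = A" using assms(6) by (simp add: self_adjoint_def)
  note setting = assms(1-3) \<rho>(1) assms(6)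
  let ?g = "wyd_correlation \<Phi> \<rho> A"
  have wyd: "wyd_skew_info t \<Phi> \<rho> A = ?g 0 - ?g t" for t
    by (simp add: wyd_skew_info_def wyd_correlation_zero[OF setting] A)
      (simp add: wyd_correlation_def)
  have V: "gen_variance \<Phi> \<rho> A = ?g 0 - \<Phi> (\<rho> * A) * \<Phi> (\<rho> * A)"
    by (simp add: gen_variance_def wyd_correlation_zero[OF setting] A)
  show ?thesis
    using wyd_correlation_le_zero[OF setting, of \<alpha>] wyd_correlation_half_le[OF setting, of \<alpha>]
      wyd_correlation_half_ge[OF setting \<rho>(2)] assms(5)
    by (simp add: cstar_le_def wy_skew_info_def wyd V)
qed

end
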